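(* Let $R$ be a commutative ring with identity and $S$ a multiplicative subset of $R$. If $F$ is a $u$-$S$-flat $R$-module, then the localization $F_S$ is flat over $R_S$.
   Context: A multiplicative subset $S$ of $R$ is a subset with $1\in S$ and $s_1s_2\in S$ for all $s_1,s_2\in S$. $R_S$ and $F_S$ denote the localizations of $R$ and $F$ at $S$. A sequence of $R$-modules $M\xrightarrow{f}N\xrightarrow{g}L$ is $u$-$S$-exact (at $N$) if there is $s\in S$ with $s\,\mathrm{Ker}(g)\subseteq \mathrm{Im}(f)$ and $s\,\mathrm{Im}(f)\subseteq \mathrm{Ker}(g)$. A sequence $0\to A\to B\to C\to 0$ is $u$-$S$-exact if it is $u$-$S$-exact at each of $A,B,C$. An $R$-module $F$ is $u$-$S$-flat if for any $u$-$S$-exact sequence $0\to A\to B\to C\to 0$, the induced sequence $0\to A\otimes_RF\to B\otimes_RF\to C\otimes_RF\to 0$ is $u$-$S$-exact. *)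

theory Defs
  imports "HOL-Algebra.Module" "HOL-Algebra.AbelCoset" "HOL-Algebra.Generated_Groups"
    "HOL-Algebra.Free_Abelian_Groups"
begin

section \<open>Linear maps and tensor products\<close>

definition linear_maps ::
  "('r, 'x) ring_scheme \<Rightarrow> ('r, 'a, 'y) module_scheme \<Rightarrow> ('r, 'b, 'z) module_scheme \<Rightarrow> ('a \<Rightarrow> 'b) set"
  where "linear_maps R M N =
    {f \<in> hom (add_monoid M) (add_monoid N).
       \<forall>r\<in>carrier R. \<forall>x\<in>carrier M. f (r \<odot>\<^bsub>M\<^esub> x) = r \<odot>\<^bsub>N\<^esub> f x}"

text \<open>
  The tensor product is the free abelian group on the pairs in
  \<open>carrier M \<times> carrier N\<close> modulo the subgroup generated by the relations of additivity in each
  argument and of balancedness, with the scalar action \<open>r (x \<otimes> y) = (r x) \<otimes> y\<close>.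
  Its elements are cosets, i.e. sets of formal \<open>\<int>\<close>-linear combinations of pairs.
\<close>

definition tensor_rels ::
  "('r, 'x) ring_scheme \<Rightarrow> ('r, 'a, 'y) module_scheme \<Rightarrow> ('r, 'b, 'z) module_scheme \<Rightarrow>
   ('a \<times> 'b \<Rightarrow>\<^sub>0 int) set"
  where "tensor_rels R M N =
    {frag_of (x \<oplus>\<^bsub>M\<^esub> x', y) - frag_of (x, y) - frag_of (x', y) | x x' y.
       x \<in> carrier M \<and> x' \<in> carrier M \<and> y \<in> carrier N} \<union>
    {frag_of (x, y \<oplus>\<^bsub>N\<^esub> y') - frag_of (x, y) - frag_of (x, y') | x y y'.
       x \<in> carrier M \<and> y \<in> carrier N \<and> y' \<in> carrier N} \<union>
    {frag_of (r \<odot>\<^bsub>M\<^esub> x, y) - frag_of (x, r \<odot>\<^bsub>N\<^esub> y) | r x y.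
       r \<in> carrier R \<and> x \<in> carrier M \<and> y \<in> carrier N}"

abbreviation tensor_free ::
  "('r, 'a, 'y) module_scheme \<Rightarrow> ('r, 'b, 'z) module_scheme \<Rightarrow> ('a \<times> 'b \<Rightarrow>\<^sub>0 int) monoid"
  where "tensor_free M N \<equiv> free_Abelian_group (carrier M \<times> carrier N)"

definition tensor_null ::
  "('r, 'x) ring_scheme \<Rightarrow> ('r, 'a, 'y) module_scheme \<Rightarrow> ('r, 'b, 'z) module_scheme \<Rightarrow>
   ('a \<times> 'b \<Rightarrow>\<^sub>0 int) set"
  where "tensor_null R M N = generate (tensor_free M N) (tensor_rels R M N)"

text \<open>
  The homomorphism of free abelian groups induced by \<open>(x, y) \<mapsto> (f x, y)\<close> sends each coset
  \<open>X\<close> into a single coset of the target; adding \<open>tensor_null\<close> to the image of \<open>X\<close> yields that coset.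
\<close>

definition tensor_map ::
  "('r, 'x) ring_scheme \<Rightarrow> ('r, 'b, 'y) module_scheme \<Rightarrow> ('r, 'f, 'z) module_scheme \<Rightarrow>
   ('a \<Rightarrow> 'b) \<Rightarrow> ('a \<times> 'f \<Rightarrow>\<^sub>0 int) set \<Rightarrow> ('b \<times> 'f \<Rightarrow>\<^sub>0 int) set"
  where "tensor_map R N F f X =
    tensor_null R N F <#>\<^bsub>tensor_free N F\<^esub> (frag_extend (\<lambda>(x, y). frag_of (f x, y)) ` X)"

text \<open>The fields \<open>mult\<close> and \<open>one\<close>, inherited from the ring record, play no role in a module.\<close>

definition tensor_product ::
  "('r, 'x) ring_scheme \<Rightarrow> ('r, 'a, 'y) module_scheme \<Rightarrow> ('r, 'b, 'z) module_scheme \<Rightarrow>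
   ('r, ('a \<times> 'b \<Rightarrow>\<^sub>0 int) set) module"
  where "tensor_product R M N =
    \<lparr>carrier = carrier (tensor_free M N Mod tensor_null R M N),
     mult = undefined,
     one = undefined,
     ring.zero = monoid.one (tensor_free M N Mod tensor_null R M N),
     ring.add = monoid.mult (tensor_free M N Mod tensor_null R M N),
     smult = (\<lambda>r. tensor_map R M N (\<lambda>x. r \<odot>\<^bsub>M\<^esub> x))\<rparr>"

definition zero_module :: "('r, unit) module"
  where "zero_module =
    \<lparr>carrier = {()}, mult = undefined, one = undefined, ring.zero = (), ring.add = (\<lambda>_ _. ()), smult = (\<lambda>_ _. ())\<rparr>"


section \<open>Flatness\<close>

definition exact_at ::
  "('r, 'a, 'x) module_scheme \<Rightarrow> ('r, 'b, 'y) module_scheme \<Rightarrow> ('r, 'c, 'z) module_scheme \<Rightarrow>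
   ('a \<Rightarrow> 'b) \<Rightarrow> ('b \<Rightarrow> 'c) \<Rightarrow> bool"
  where "exact_at M N L f g \<longleftrightarrow> f ` carrier M = a_kernel N L g"

definition short_exact ::
  "('r, 'a, 'x) module_scheme \<Rightarrow> ('r, 'b, 'y) module_scheme \<Rightarrow> ('r, 'c, 'z) module_scheme \<Rightarrow>
   ('a \<Rightarrow> 'b) \<Rightarrow> ('b \<Rightarrow> 'c) \<Rightarrow> bool"
  where "short_exact A B C f g \<longleftrightarrow>
    exact_at zero_module A B (\<lambda>_. \<zero>\<^bsub>A\<^esub>) f \<and>
    exact_at A B C f g \<and>
    exact_at B C zero_module g (\<lambda>_. ())"

definition u_S_exact_at ::
  "'r set \<Rightarrow> ('r, 'a, 'x) module_scheme \<Rightarrow> ('r, 'b, 'y) module_scheme \<Rightarrow> ('r, 'c, 'z) module_scheme \<Rightarrow>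
   ('a \<Rightarrow> 'b) \<Rightarrow> ('b \<Rightarrow> 'c) \<Rightarrow> bool"
  where "u_S_exact_at S M N L f g \<longleftrightarrow>
    (\<exists>s\<in>S. (\<lambda>x. s \<odot>\<^bsub>N\<^esub> x) ` a_kernel N L g \<subseteq> f ` carrier M \<and>
           (\<lambda>x. s \<odot>\<^bsub>N\<^esub> x) ` (f ` carrier M) \<subseteq> a_kernel N L g)"

definition u_S_short_exact ::
  "'r set \<Rightarrow> ('r, 'a, 'x) module_scheme \<Rightarrow> ('r, 'b, 'y) module_scheme \<Rightarrow> ('r, 'c, 'z) module_scheme \<Rightarrow>
   ('a \<Rightarrow> 'b) \<Rightarrow> ('b \<Rightarrow> 'c) \<Rightarrow> bool"
  where "u_S_short_exact S A B C f g \<longleftrightarrow>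
    u_S_exact_at S zero_module A B (\<lambda>_. \<zero>\<^bsub>A\<^esub>) f \<and>
    u_S_exact_at S A B C f g \<and>
    u_S_exact_at S B C zero_module g (\<lambda>_. ())"

text \<open>
  A HOL definition cannot quantify over all types, so the type \<open>'m\<close> that carries the test modules
  \<open>A\<close>, \<open>B\<close>, \<open>C\<close> is an explicit parameter playing the role of a universe.  Quantification over all
  modules corresponds to quantification over all \<open>'m\<close>.
\<close>

definition flat_module ::
  "'m itself \<Rightarrow> ('r, 'x) ring_scheme \<Rightarrow> ('r, 'f, 'y) module_scheme \<Rightarrow> bool"
  where "flat_module U R F \<longleftrightarrow> module R F \<and>
    (\<forall>(A :: ('r, 'm) module) (B :: ('r, 'm) module) (C :: ('r, 'm) module) f g.
       module R A \<longrightarrow> module R B \<longrightarrow> module R C \<longrightarrow>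
       f \<in> linear_maps R A B \<longrightarrow> g \<in> linear_maps R B C \<longrightarrow>
       short_exact A B C f g \<longrightarrow>
       short_exact (tensor_product R A F) (tensor_product R B F) (tensor_product R C F)
         (tensor_map R B F f) (tensor_map R C F g))"

definition u_S_flat_module ::
  "'m itself \<Rightarrow> ('r, 'x) ring_scheme \<Rightarrow> 'r set \<Rightarrow> ('r, 'f, 'y) module_scheme \<Rightarrow> bool"
  where "u_S_flat_module U R S F \<longleftrightarrow> module R F \<and>
    (\<forall>(A :: ('r, 'm) module) (B :: ('r, 'm) module) (C :: ('r, 'm) module) f g.
       module R A \<longrightarrow> module R B \<longrightarrow> module R C \<longrightarrow>
       f \<in> linear_maps R A B \<longrightarrow> g \<in> linear_maps R B C \<longrightarrow>
       u_S_short_exact S A B C f g \<longrightarrow>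
       u_S_short_exact S (tensor_product R A F) (tensor_product R B F) (tensor_product R C F)
         (tensor_map R B F f) (tensor_map R C F g))"


section \<open>Localization\<close>

text \<open>A multiplicative subset of \<open>R\<close> is exactly a set \<open>S\<close> with \<open>submonoid S R\<close>.\<close>

definition loc_rel :: "('r, 'x) ring_scheme \<Rightarrow> 'r set \<Rightarrow> (('r \<times> 'r) \<times> ('r \<times> 'r)) set"
  where "loc_rel R S =
    {((a, s), (b, t)) | a s b t. a \<in> carrier R \<and> b \<in> carrier R \<and> s \<in> S \<and> t \<in> S \<and>
       (\<exists>u\<in>S. u \<otimes>\<^bsub>R\<^esub> (t \<otimes>\<^bsub>R\<^esub> a) = u \<otimes>\<^bsub>R\<^esub> (s \<otimes>\<^bsub>R\<^esub> b))}"

definition loc_ring :: "('r, 'x) ring_scheme \<Rightarrow> 'r set \<Rightarrow> ('r \<times> 'r) set ring"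
  where "loc_ring R S =
    \<lparr>carrier = (carrier R \<times> S) // loc_rel R S,
     mult = (\<lambda>X Y. \<Union>(a, s)\<in>X. \<Union>(b, t)\<in>Y. loc_rel R S `` {(a \<otimes>\<^bsub>R\<^esub> b, s \<otimes>\<^bsub>R\<^esub> t)}),
     one = loc_rel R S `` {(\<one>\<^bsub>R\<^esub>, \<one>\<^bsub>R\<^esub>)},
     ring.zero = loc_rel R S `` {(\<zero>\<^bsub>R\<^esub>, \<one>\<^bsub>R\<^esub>)},
     ring.add = (\<lambda>X Y. \<Union>(a, s)\<in>X. \<Union>(b, t)\<in>Y.
       loc_rel R S `` {(t \<otimes>\<^bsub>R\<^esub> a \<oplus>\<^bsub>R\<^esub> s \<otimes>\<^bsub>R\<^esub> b, s \<otimes>\<^bsub>R\<^esub> t)})\<rparr>"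

definition loc_mod_rel ::
  "('r, 'f, 'y) module_scheme \<Rightarrow> 'r set \<Rightarrow> (('f \<times> 'r) \<times> ('f \<times> 'r)) set"
  where "loc_mod_rel M S =
    {((x, s), (y, t)) | x s y t. x \<in> carrier M \<and> y \<in> carrier M \<and> s \<in> S \<and> t \<in> S \<and>
       (\<exists>u\<in>S. u \<odot>\<^bsub>M\<^esub> (t \<odot>\<^bsub>M\<^esub> x) = u \<odot>\<^bsub>M\<^esub> (s \<odot>\<^bsub>M\<^esub> y))}"

definition loc_module ::
  "('r, 'x) ring_scheme \<Rightarrow> 'r set \<Rightarrow> ('r, 'f, 'y) module_scheme \<Rightarrow>
   (('r \<times> 'r) set, ('f \<times> 'r) set) module"
  where "loc_module R S M =
    \<lparr>carrier = (carrier M \<times> S) // loc_mod_rel M S,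
     mult = undefined,
     one = undefined,
     ring.zero = loc_mod_rel M S `` {(\<zero>\<^bsub>M\<^esub>, \<one>\<^bsub>R\<^esub>)},
     ring.add = (\<lambda>X Y. \<Union>(x, s)\<in>X. \<Union>(y, t)\<in>Y.
       loc_mod_rel M S `` {(t \<odot>\<^bsub>M\<^esub> x \<oplus>\<^bsub>M\<^esub> s \<odot>\<^bsub>M\<^esub> y, s \<otimes>\<^bsub>R\<^esub> t)}),
     smult = (\<lambda>X Y. \<Union>(a, s)\<in>X. \<Union>(y, t)\<in>Y.
       loc_mod_rel M S `` {(a \<odot>\<^bsub>M\<^esub> y, s \<otimes>\<^bsub>R\<^esub> t)})\<rparr>"

end

theory Submission
  imports Defs
begin

text \<open>
  Let \<open>0 \<rightarrow> A \<rightarrow> B \<rightarrow> C \<rightarrow> 0\<close> be an exact sequence of modules over the localized ring.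
  Restricted to \<open>R\<close> along \<open>r \<mapsto> r / 1\<close>, it is still exact and hence uniformly \<open>S\<close>-exact with
  witness \<open>1\<close>; the carriers do not change, so the restricted modules are legitimate test modules for
  \<open>F\<close>.  The hypothesis then says that tensoring over \<open>R\<close> with \<open>F\<close> gives a uniformly \<open>S\<close>-exact
  sequence.

  Two observations turn this into exactness over the localized ring.  On \<open>A \<otimes> F\<close> over \<open>R\<close> every element
  of \<open>S\<close> acts bijectively, because it does so on \<open>A\<close> (\<open>eq_unscale\<close>); so the scalar in uniform exactness
  can be divided out.  And for every module \<open>A\<close> over the localized ring, the tensor product of \<open>A\<close> with
  the localization of \<open>F\<close> over the localized ring is naturally isomorphic to \<open>A \<otimes> F\<close> over \<open>R\<close>, by
  \<open>a \<otimes> (x / s) \<mapsto> (1 / s) a \<otimes> x\<close> (\<open>delocalize_tensor_eq\<close>) and \<open>a \<otimes> x \<mapsto> a \<otimes> (x / 1)\<close>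
  (\<open>localize_tensor_eq\<close>).  Exactness is carried back from \<open>A \<otimes> F\<close> as follows: a tensor over the
  localized ring is sent to \<open>R\<close>, the hypothesis is applied there, and the result is sent back; it returns
  to the original tensor because the first map followed by the second is the identity
  (\<open>localize_delocalize\<close>).

  All computations with tensors are done on formal combinations of pairs modulo the defining
  relations; \<open>short_exactI\<close> and \<open>u_S_short_exactD\<close> translate between this description and exactness of
  the sequences of tensor products.
\<close>

section \<open>Localized rings and modules\<close>

definition module_frac :: "('r, 'm, 'y) module_scheme \<Rightarrow> 'r set \<Rightarrow> 'm \<Rightarrow> 'r \<Rightarrow> ('m \<times> 'r) set"
  where "module_frac M S x s = loc_mod_rel M S `` {(x, s)}"

definition ring_frac :: "('r, 'x) ring_scheme \<Rightarrow> 'r set \<Rightarrow> 'r \<Rightarrow> 'r \<Rightarrow> ('r \<times> 'r) set"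
  where "ring_frac R S a s = loc_rel R S `` {(a, s)}"

definition regular_module :: "('r, 'x) ring_scheme \<Rightarrow> ('r, 'r) module"
  where "regular_module R =
    \<lparr>carrier = carrier R, mult = monoid.mult R, one = monoid.one R,
     ring.zero = ring.zero R, ring.add = ring.add R, smult = monoid.mult R\<rparr>"

lemma regular_module_simps [simp]:
  "carrier (regular_module R) = carrier R"
  "ring.zero (regular_module R) = ring.zero R"
  "ring.add (regular_module R) = ring.add R"
  "smult (regular_module R) = monoid.mult R"
  by (simp_all add: regular_module_def)

lemma module_regular_module:
  assumes "cring R"
  shows "module R (regular_module R)"
proof -
  interpret cring R by fact
  show ?thesis
    by (rule moduleI)
       (auto intro!: abelian_groupI simp: cring_axioms a_ac l_distr r_distr m_assoc
          intro: exI[of _ "\<ominus>\<^bsub>R\<^esub> _"] bexI[of _ "\<ominus>\<^bsub>R\<^esub> _"] l_neg)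
qed

lemma loc_rel_regular_module: "loc_rel R S = loc_mod_rel (regular_module R) S"
  by (simp add: loc_rel_def loc_mod_rel_def)

lemma ring_frac_regular_module: "ring_frac R S = module_frac (regular_module R) S"
  by (simp add: fun_eq_iff ring_frac_def module_frac_def loc_rel_regular_module)

text \<open>
  Ring fractions are the module fractions of the regular module, and the product of ring fractions
  is their scalar product there; so the ring axioms of a localized ring are module axioms of the
  localized regular module.
\<close>

lemma loc_ring_simps:
  "carrier (loc_ring R S) = carrier (loc_module R S (regular_module R))"
  "ring.zero (loc_ring R S) = ring.zero (loc_module R S (regular_module R))"
  "ring.add (loc_ring R S) = ring.add (loc_module R S (regular_module R))"
  "monoid.mult (loc_ring R S) = smult (loc_module R S (regular_module R))"
  "monoid.one (loc_ring R S) = ring_frac R S \<one>\<^bsub>R\<^esub> \<one>\<^bsub>R\<^esub>"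
  by (simp_all add: loc_ring_def loc_module_def loc_rel_regular_module ring_frac_def)

locale localization = module R M for R (structure) and M (structure) +
  fixes S
  assumes submonoid: "submonoid S R"
begin

sublocale submonoid S R
  by (rule submonoid)

lemma equiv_loc_mod_rel: "equiv (carrier M \<times> S) (loc_mod_rel M S)"
proof (rule equivI)
  show "loc_mod_rel M S \<subseteq> (carrier M \<times> S) \<times> (carrier M \<times> S)"
    by (auto simp: loc_mod_rel_def)
  show "refl_on (carrier M \<times> S) (loc_mod_rel M S)"
    by (auto simp: loc_mod_rel_def refl_on_def intro: one_closed)
  show "sym (loc_mod_rel M S)"
    by (auto simp: loc_mod_rel_def sym_def; metis)
  show "trans (loc_mod_rel M S)"
  proof (rule transI)
    fix p q r
    assume "(p, q) \<in> loc_mod_rel M S" "(q, r) \<in> loc_mod_rel M S"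
    then obtain x s y t z w u v where eqs: "p = (x, s)" "q = (y, t)" "r = (z, w)"
      and c [simp]: "x \<in> carrier M" "y \<in> carrier M" "z \<in> carrier M"
        "s \<in> S" "t \<in> S" "w \<in> S" "u \<in> S" "v \<in> S"
      and u: "u \<odot>\<^bsub>M\<^esub> (t \<odot>\<^bsub>M\<^esub> x) = u \<odot>\<^bsub>M\<^esub> (s \<odot>\<^bsub>M\<^esub> y)"
      and v: "v \<odot>\<^bsub>M\<^esub> (w \<odot>\<^bsub>M\<^esub> y) = v \<odot>\<^bsub>M\<^esub> (t \<odot>\<^bsub>M\<^esub> z)"
      by (force simp: loc_mod_rel_def)
    have "(u \<otimes> v \<otimes> t) \<odot>\<^bsub>M\<^esub> (w \<odot>\<^bsub>M\<^esub> x) = (v \<otimes> w) \<odot>\<^bsub>M\<^esub> (u \<odot>\<^bsub>M\<^esub> (t \<odot>\<^bsub>M\<^esub> x))"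
      by (simp add: smult_assoc1[symmetric] m_ac)
    also have "\<dots> = (u \<otimes> s) \<odot>\<^bsub>M\<^esub> (v \<odot>\<^bsub>M\<^esub> (w \<odot>\<^bsub>M\<^esub> y))"
      by (simp add: u) (simp add: smult_assoc1[symmetric] m_ac)
    also have "\<dots> = (u \<otimes> v \<otimes> t) \<odot>\<^bsub>M\<^esub> (s \<odot>\<^bsub>M\<^esub> z)"
      by (simp add: v) (simp add: smult_assoc1[symmetric] m_ac)
    finally show "(p, r) \<in> loc_mod_rel M S"
      by (auto simp: loc_mod_rel_def eqs intro!: bexI[of _ "u \<otimes> v \<otimes> t"])
  qed
qed

lemma frac_eqI:
  assumes "x \<in> carrier M" "y \<in> carrier M" "s \<in> S" "t \<in> S" "u \<in> S"
    and "u \<odot>\<^bsub>M\<^esub> (t \<odot>\<^bsub>M\<^esub> x) = u \<odot>\<^bsub>M\<^esub> (s \<odot>\<^bsub>M\<^esub> y)"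
  shows "module_frac M S x s = module_frac M S y t"
  unfolding module_frac_def
  by (rule equiv_class_eq[OF equiv_loc_mod_rel]) (use assms in \<open>auto simp: loc_mod_rel_def\<close>)

lemma frac_eqE:
  assumes "module_frac M S x s = module_frac M S y t" "x \<in> carrier M" "y \<in> carrier M" "s \<in> S" "t \<in> S"
  obtains u where "u \<in> S" "u \<odot>\<^bsub>M\<^esub> (t \<odot>\<^bsub>M\<^esub> x) = u \<odot>\<^bsub>M\<^esub> (s \<odot>\<^bsub>M\<^esub> y)"
proof -
  have "((x, s), (y, t)) \<in> loc_mod_rel M S"
    by (rule eq_equiv_class[OF _ equiv_loc_mod_rel]) (use assms in \<open>auto simp: module_frac_def\<close>)
  then show thesis
    by (auto simp: loc_mod_rel_def intro: that)
qed

text \<open>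
  Common factors cancel; the distributive laws below need this because the two sides of such a law
  acquire denominators that differ by a repeated factor.
\<close>

lemma frac_cancel:
  assumes "x \<in> carrier M" "s \<in> S" "u \<in> S"
  shows "module_frac M S (u \<odot>\<^bsub>M\<^esub> x) (u \<otimes> s) = module_frac M S x s"
  by (rule frac_eqI[of _ _ _ _ \<one>]) (use assms in \<open>auto simp: smult_assoc1[symmetric] m_ac\<close>)

lemma frac_closed [simp]:
  "x \<in> carrier M \<Longrightarrow> s \<in> S \<Longrightarrow> module_frac M S x s \<in> carrier (loc_module R S M)"
  by (auto simp: loc_module_def module_frac_def intro: quotientI)

lemma fracE:
  assumes "X \<in> carrier (loc_module R S M)"
  obtains x s where "x \<in> carrier M" "s \<in> S" "X = module_frac M S x s"
  using assms by (auto simp: loc_module_def module_frac_def elim!: quotientE)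

lemma add_frac:
  assumes "x \<in> carrier M" "y \<in> carrier M" "s \<in> S" "t \<in> S"
  shows "module_frac M S x s \<oplus>\<^bsub>loc_module R S M\<^esub> module_frac M S y t
    = module_frac M S (t \<odot>\<^bsub>M\<^esub> x \<oplus>\<^bsub>M\<^esub> s \<odot>\<^bsub>M\<^esub> y) (s \<otimes> t)"
proof -
  let ?f = "\<lambda>p q. case p of (x, s) \<Rightarrow> case q of (y, t) \<Rightarrow>
    module_frac M S (t \<odot>\<^bsub>M\<^esub> x \<oplus>\<^bsub>M\<^esub> s \<odot>\<^bsub>M\<^esub> y) (s \<otimes> t)"
  have "congruent2 (loc_mod_rel M S) (loc_mod_rel M S) ?f"
  proof (rule congruent2I')
    fix p p' q q'
    assume "(p, p') \<in> loc_mod_rel M S" "(q, q') \<in> loc_mod_rel M S"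
    then obtain x s x' s' y t y' t' u v where
      eqs: "p = (x, s)" "p' = (x', s')" "q = (y, t)" "q' = (y', t')"
      and c [simp]: "x \<in> carrier M" "x' \<in> carrier M" "y \<in> carrier M" "y' \<in> carrier M"
        "s \<in> S" "s' \<in> S" "t \<in> S" "t' \<in> S" "u \<in> S" "v \<in> S"
      and u: "u \<odot>\<^bsub>M\<^esub> (s' \<odot>\<^bsub>M\<^esub> x) = u \<odot>\<^bsub>M\<^esub> (s \<odot>\<^bsub>M\<^esub> x')"
      and v: "v \<odot>\<^bsub>M\<^esub> (t' \<odot>\<^bsub>M\<^esub> y) = v \<odot>\<^bsub>M\<^esub> (t \<odot>\<^bsub>M\<^esub> y')"
      by (force simp: loc_mod_rel_def)
    have "(u \<otimes> v) \<odot>\<^bsub>M\<^esub> ((s' \<otimes> t') \<odot>\<^bsub>M\<^esub> (t \<odot>\<^bsub>M\<^esub> x \<oplus>\<^bsub>M\<^esub> s \<odot>\<^bsub>M\<^esub> y))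
      = (v \<otimes> t' \<otimes> t) \<odot>\<^bsub>M\<^esub> (u \<odot>\<^bsub>M\<^esub> (s' \<odot>\<^bsub>M\<^esub> x)) \<oplus>\<^bsub>M\<^esub> (u \<otimes> s' \<otimes> s) \<odot>\<^bsub>M\<^esub> (v \<odot>\<^bsub>M\<^esub> (t' \<odot>\<^bsub>M\<^esub> y))"
      by (simp add: smult_assoc1[symmetric] smult_r_distr m_ac)
    also have "\<dots> = (u \<otimes> v) \<odot>\<^bsub>M\<^esub> ((s \<otimes> t) \<odot>\<^bsub>M\<^esub> (t' \<odot>\<^bsub>M\<^esub> x' \<oplus>\<^bsub>M\<^esub> s' \<odot>\<^bsub>M\<^esub> y'))"
      by (simp add: u v) (simp add: smult_assoc1[symmetric] smult_r_distr m_ac)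
    finally show "?f p q = ?f p' q'"
      by (simp only: eqs prod.case, intro frac_eqI[of _ _ _ _ "u \<otimes> v"]) auto
  qed
  from UN_equiv_class2[OF equiv_loc_mod_rel equiv_loc_mod_rel this, of "(x, s)" "(y, t)"]
  show ?thesis using assms by (simp add: loc_module_def case_prod_unfold module_frac_def)
qed

lemma zero_loc_module: "\<zero>\<^bsub>loc_module R S M\<^esub> = module_frac M S \<zero>\<^bsub>M\<^esub> \<one>"
  by (simp add: loc_module_def module_frac_def)

lemma frac_zero: "s \<in> S \<Longrightarrow> module_frac M S \<zero>\<^bsub>M\<^esub> s = module_frac M S \<zero>\<^bsub>M\<^esub> \<one>"
  by (rule frac_eqI[of _ _ _ _ \<one>]) auto

lemma abelian_group_loc_module: "abelian_group (loc_module R S M)"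
proof (rule abelian_groupI)
  fix X assume "X \<in> carrier (loc_module R S M)"
  then obtain x s where X: "x \<in> carrier M" "s \<in> S" "X = module_frac M S x s"
    by (rule fracE)
  then show "\<zero>\<^bsub>loc_module R S M\<^esub> \<oplus>\<^bsub>loc_module R S M\<^esub> X = X"
    by (simp add: zero_loc_module add_frac)
  have "s \<odot>\<^bsub>M\<^esub> (\<ominus>\<^bsub>M\<^esub> x) \<oplus>\<^bsub>M\<^esub> s \<odot>\<^bsub>M\<^esub> x = \<zero>\<^bsub>M\<^esub>"
    using X by (simp add: smult_r_distr[symmetric] M.l_neg)
  then have "module_frac M S (\<ominus>\<^bsub>M\<^esub> x) s \<oplus>\<^bsub>loc_module R S M\<^esub> X = \<zero>\<^bsub>loc_module R S M\<^esub>"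
    using X by (simp only: zero_loc_module add_frac frac_zero M.a_inv_closed m_closed)
  then show "\<exists>Y\<in>carrier (loc_module R S M). Y \<oplus>\<^bsub>loc_module R S M\<^esub> X = \<zero>\<^bsub>loc_module R S M\<^esub>"
    using X by (intro bexI[of _ "module_frac M S (\<ominus>\<^bsub>M\<^esub> x) s"]) auto
next
  fix X Y Z
  assume "X \<in> carrier (loc_module R S M)" "Y \<in> carrier (loc_module R S M)"
    "Z \<in> carrier (loc_module R S M)"
  then obtain x s y t z u where c: "x \<in> carrier M" "y \<in> carrier M" "z \<in> carrier M" "s \<in> S" "t \<in> S" "u \<in> S"
    "X = module_frac M S x s" "Y = module_frac M S y t" "Z = module_frac M S z u"
    by (auto elim!: fracE)
  then show "X \<oplus>\<^bsub>loc_module R S M\<^esub> Y \<oplus>\<^bsub>loc_module R S M\<^esub> Z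
      = X \<oplus>\<^bsub>loc_module R S M\<^esub> (Y \<oplus>\<^bsub>loc_module R S M\<^esub> Z)"
    by (simp add: add_frac smult_r_distr smult_assoc1[symmetric] m_ac M.a_assoc)
qed (auto simp: add_frac zero_loc_module m_comm M.a_comm elim!: fracE)

sublocale regular: module R "regular_module R"
  by (rule module_regular_module) (rule R.is_cring)

sublocale regular: localization R "regular_module R" S
  by unfold_locales

lemmas ring_frac_closed [simp] =
  regular.frac_closed[folded ring_frac_regular_module, unfolded loc_ring_simps(1)[symmetric], simplified]
lemmas ring_fracE =
  regular.fracE[folded ring_frac_regular_module, unfolded loc_ring_simps(1)[symmetric], simplified]
lemmas ring_frac_cancel = regular.frac_cancel[folded ring_frac_regular_module, simplified]
lemmas add_ring_frac =
  regular.add_frac[folded ring_frac_regular_module, unfolded loc_ring_simps(3)[symmetric], simplified]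

text \<open>
  Numerator and denominator of both arguments may change at once: multiplying the two witnesses of
  equality of fractions gives a witness for the product.
\<close>

lemma smult_frac:
  assumes "a \<in> carrier R" "y \<in> carrier M" "s \<in> S" "t \<in> S"
  shows "ring_frac R S a s \<odot>\<^bsub>loc_module R S M\<^esub> module_frac M S y t = module_frac M S (a \<odot>\<^bsub>M\<^esub> y) (s \<otimes> t)"
proof -
  let ?f = "\<lambda>p q. case p of (a, s) \<Rightarrow> case q of (y, t) \<Rightarrow> module_frac M S (a \<odot>\<^bsub>M\<^esub> y) (s \<otimes> t)"
  have "congruent2 (loc_rel R S) (loc_mod_rel M S) ?f"
  proof (rule congruent2I')
    fix p p' q q'
    assume "(p, p') \<in> loc_rel R S" "(q, q') \<in> loc_mod_rel M S"
    then obtain a s a' s' y t y' t' u v where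
      eqs: "p = (a, s)" "p' = (a', s')" "q = (y, t)" "q' = (y', t')"
      and c [simp]: "a \<in> carrier R" "a' \<in> carrier R" "y \<in> carrier M" "y' \<in> carrier M"
        "s \<in> S" "s' \<in> S" "t \<in> S" "t' \<in> S" "u \<in> S" "v \<in> S"
      and u: "u \<otimes> (s' \<otimes> a) = u \<otimes> (s \<otimes> a')"
      and v: "v \<odot>\<^bsub>M\<^esub> (t' \<odot>\<^bsub>M\<^esub> y) = v \<odot>\<^bsub>M\<^esub> (t \<odot>\<^bsub>M\<^esub> y')"
      by (force simp: loc_mod_rel_def loc_rel_def)
    have "(u \<otimes> v) \<odot>\<^bsub>M\<^esub> ((s' \<otimes> t') \<odot>\<^bsub>M\<^esub> (a \<odot>\<^bsub>M\<^esub> y)) = (u \<otimes> (s' \<otimes> a)) \<odot>\<^bsub>M\<^esub> (v \<odot>\<^bsub>M\<^esub> (t' \<odot>\<^bsub>M\<^esub> y))"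
      by (simp add: smult_assoc1[symmetric] m_ac)
    also have "\<dots> = (u \<otimes> v) \<odot>\<^bsub>M\<^esub> ((s \<otimes> t) \<odot>\<^bsub>M\<^esub> (a' \<odot>\<^bsub>M\<^esub> y'))"
      by (simp only: u v) (simp add: smult_assoc1[symmetric] m_ac)
    finally show "?f p q = ?f p' q'"
      by (simp only: eqs prod.case, intro frac_eqI[of _ _ _ _ "u \<otimes> v"]) auto
  qed
  from UN_equiv_class2[OF regular.equiv_loc_mod_rel[folded loc_rel_regular_module]
      equiv_loc_mod_rel this, of "(a, s)" "(y, t)"]
  show ?thesis using assms by (simp add: loc_module_def case_prod_unfold module_frac_def ring_frac_def)
qed

end

context localization
begin

lemmas mult_ring_frac =
  regular.smult_frac[folded ring_frac_regular_module, unfolded loc_ring_simps(4)[symmetric], simplified]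

lemma cring_loc_ring: "cring (loc_ring R S)"
proof (rule cringI)
  interpret L: abelian_group "loc_module R S (regular_module R)"
    by (rule regular.abelian_group_loc_module)
  show "abelian_group (loc_ring R S)"
    by (rule abelian_groupI)
       (auto simp: loc_ring_simps L.a_ac intro: bexI[of _ "\<ominus>\<^bsub>loc_module R S (regular_module R)\<^esub> _"] L.l_neg)
  show "comm_monoid (loc_ring R S)"
    by (rule comm_monoidI)
       (auto elim!: ring_fracE simp: mult_ring_frac loc_ring_simps(5) m_ac)
next
  fix X Y Z
  assume "X \<in> carrier (loc_ring R S)" "Y \<in> carrier (loc_ring R S)" "Z \<in> carrier (loc_ring R S)"
  then obtain a s b t d u where c: "a \<in> carrier R" "b \<in> carrier R" "d \<in> carrier R" "s \<in> S" "t \<in> S" "u \<in> S"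
    "X = ring_frac R S a s" "Y = ring_frac R S b t" "Z = ring_frac R S d u"
    by (auto elim!: ring_fracE)
  then show "(X \<oplus>\<^bsub>loc_ring R S\<^esub> Y) \<otimes>\<^bsub>loc_ring R S\<^esub> Z
    = X \<otimes>\<^bsub>loc_ring R S\<^esub> Z \<oplus>\<^bsub>loc_ring R S\<^esub> Y \<otimes>\<^bsub>loc_ring R S\<^esub> Z"
    using ring_frac_cancel[of "(t \<otimes> a \<oplus> s \<otimes> b) \<otimes> d" "s \<otimes> t \<otimes> u" u]
    by (simp add: mult_ring_frac add_ring_frac l_distr r_distr m_ac)
qed

lemma module_loc_module: "module (loc_ring R S) (loc_module R S M)"
proof (rule moduleI[OF cring_loc_ring abelian_group_loc_module])
  fix X Y Z W
  assume "X \<in> carrier (loc_ring R S)" "Y \<in> carrier (loc_ring R S)"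
    "Z \<in> carrier (loc_module R S M)"
  then obtain a s b t d u where c: "a \<in> carrier R" "b \<in> carrier R" "d \<in> carrier M" "s \<in> S" "t \<in> S" "u \<in> S"
    "X = ring_frac R S a s" "Y = ring_frac R S b t" "Z = module_frac M S d u"
    by (auto elim!: ring_fracE fracE)
  then show "(X \<oplus>\<^bsub>loc_ring R S\<^esub> Y) \<odot>\<^bsub>loc_module R S M\<^esub> Z
    = X \<odot>\<^bsub>loc_module R S M\<^esub> Z \<oplus>\<^bsub>loc_module R S M\<^esub> Y \<odot>\<^bsub>loc_module R S M\<^esub> Z"
    using frac_cancel[of "(t \<otimes> a \<oplus> s \<otimes> b) \<odot>\<^bsub>M\<^esub> d" "s \<otimes> t \<otimes> u" u]
    by (simp add: smult_frac add_frac add_ring_frac smult_l_distr smult_r_distr smult_assoc1[symmetric] m_ac)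
  show "(X \<otimes>\<^bsub>loc_ring R S\<^esub> Y) \<odot>\<^bsub>loc_module R S M\<^esub> Z
    = X \<odot>\<^bsub>loc_module R S M\<^esub> (Y \<odot>\<^bsub>loc_module R S M\<^esub> Z)"
    using c by (simp add: smult_frac mult_ring_frac smult_assoc1 m_ac)
next
  fix X Y Z
  assume "X \<in> carrier (loc_ring R S)" "Y \<in> carrier (loc_module R S M)"
    "Z \<in> carrier (loc_module R S M)"
  then obtain a s b t d u where c: "a \<in> carrier R" "b \<in> carrier M" "d \<in> carrier M" "s \<in> S" "t \<in> S" "u \<in> S"
    "X = ring_frac R S a s" "Y = module_frac M S b t" "Z = module_frac M S d u"
    by (auto elim!: ring_fracE fracE)
  then show "X \<odot>\<^bsub>loc_module R S M\<^esub> (Y \<oplus>\<^bsub>loc_module R S M\<^esub> Z)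
    = X \<odot>\<^bsub>loc_module R S M\<^esub> Y \<oplus>\<^bsub>loc_module R S M\<^esub> X \<odot>\<^bsub>loc_module R S M\<^esub> Z"
    using frac_cancel[of "a \<odot>\<^bsub>M\<^esub> (u \<odot>\<^bsub>M\<^esub> b \<oplus>\<^bsub>M\<^esub> t \<odot>\<^bsub>M\<^esub> d)" "s \<otimes> (t \<otimes> u)" s]
    by (simp add: smult_frac add_frac smult_l_distr smult_r_distr smult_assoc1[symmetric] m_ac)
qed (auto elim!: ring_fracE fracE simp: smult_frac loc_ring_simps(5))

end
section \<open>Restriction of scalars\<close>

definition restrict_scalars :: "('r \<Rightarrow> 's) \<Rightarrow> ('s, 'm, 'y) module_scheme \<Rightarrow> ('r, 'm) module"
  where "restrict_scalars h A =
    \<lparr>carrier = carrier A, mult = undefined, one = undefined,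
     ring.zero = ring.zero A, ring.add = ring.add A, smult = (\<lambda>r x. h r \<odot>\<^bsub>A\<^esub> x)\<rparr>"

lemma restrict_scalars_simps [simp]:
  "carrier (restrict_scalars h A) = carrier A"
  "ring.zero (restrict_scalars h A) = ring.zero A"
  "ring.add (restrict_scalars h A) = ring.add A"
  "smult (restrict_scalars h A) r x = h r \<odot>\<^bsub>A\<^esub> x"
  by (simp_all add: restrict_scalars_def)

lemma module_restrict_scalars:
  assumes "cring R" "module R' A" "h \<in> ring_hom R R'"
  shows "module R (restrict_scalars h A)"
proof -
  interpret A: module R' A by fact
  note h = ring_hom_closed[OF assms(3)] ring_hom_mult[OF assms(3)]
    ring_hom_add[OF assms(3)] ring_hom_one[OF assms(3)]
  have "abelian_group (restrict_scalars h A)"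
    by (rule abelian_groupI)
       (auto simp: A.M.a_ac intro: bexI[of _ "\<ominus>\<^bsub>A\<^esub> _"] A.M.l_neg)
  then show ?thesis
    by (rule moduleI[OF \<open>cring R\<close>])
       (auto simp: h A.smult_l_distr A.smult_r_distr A.smult_assoc1)
qed

lemma linear_maps_restrict_scalars:
  assumes "f \<in> linear_maps R' A B" "h \<in> ring_hom R R'"
  shows "f \<in> linear_maps R (restrict_scalars h A) (restrict_scalars h B)"
  using assms by (auto simp: linear_maps_def hom_def ring_hom_closed)

lemma short_exact_restrict_scalars:
  "short_exact (restrict_scalars h A) (restrict_scalars h B) (restrict_scalars h C) f g
    \<longleftrightarrow> short_exact A B C f g"
  by (simp add: short_exact_def exact_at_def a_kernel_def' zero_module_def)

text \<open>
  The scalar \<open>1\<close> witnesses uniform exactness, so the flatness hypothesis can be applied to every exact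
  sequence.
\<close>

lemma exact_at_imp_u_S_exact_at:
  assumes "exact_at M N L f g" "module R N" "\<one>\<^bsub>R\<^esub> \<in> S"
  shows "u_S_exact_at S M N L f g"
proof -
  have "(\<lambda>x. \<one>\<^bsub>R\<^esub> \<odot>\<^bsub>N\<^esub> x) ` a_kernel N L g = a_kernel N L g"
    using module.smult_one[OF assms(2)] by (force simp: a_kernel_def')
  with assms(1) show ?thesis
    unfolding u_S_exact_at_def exact_at_def by (intro bexI[OF _ assms(3)]) simp
qed

lemma short_exact_imp_u_S_short_exact:
  assumes "short_exact A B C f g" "module R A" "module R B" "module R C" "\<one>\<^bsub>R\<^esub> \<in> S"
  shows "u_S_short_exact S A B C f g"
  using assms by (simp add: short_exact_def u_S_short_exact_def exact_at_imp_u_S_exact_at)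


section \<open>Tensor products by representatives\<close>

text \<open>
  Cosets are avoided as long as possible: a statement about a tensor product is expressed by
  formal combinations of pairs, with the congruence modulo the defining relations in place of equality.
  Additive maps are then plain \<open>frag_extend\<close>s, and identities between them can be checked on pairs.
\<close>

definition tensor_eq ::
  "('r, 'x) ring_scheme \<Rightarrow> ('r, 'a, 'y) module_scheme \<Rightarrow> ('r, 'b, 'z) module_scheme \<Rightarrow>
   ('a \<times> 'b \<Rightarrow>\<^sub>0 int) \<Rightarrow> ('a \<times> 'b \<Rightarrow>\<^sub>0 int) \<Rightarrow> bool"
  where "tensor_eq R M N z w \<longleftrightarrow> z - w \<in> tensor_null R M N"

definition tensor_class ::
  "('r, 'x) ring_scheme \<Rightarrow> ('r, 'a, 'y) module_scheme \<Rightarrow> ('r, 'b, 'z) module_scheme \<Rightarrow>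
   ('a \<times> 'b \<Rightarrow>\<^sub>0 int) \<Rightarrow> ('a \<times> 'b \<Rightarrow>\<^sub>0 int) set"
  where "tensor_class R M N z = tensor_null R M N #>\<^bsub>tensor_free M N\<^esub> z"

text \<open>
  This is the map \<open>f \<otimes> id\<close> on representatives.  It does not mention the modules, so that the same
  term serves for the tensor products over both rings.
\<close>

definition left_map :: "('a \<Rightarrow> 'b) \<Rightarrow> ('a \<times> 'f \<Rightarrow>\<^sub>0 int) \<Rightarrow> ('b \<times> 'f \<Rightarrow>\<^sub>0 int)"
  where "left_map f = frag_extend (\<lambda>(x, y). frag_of (f x, y))"

lemma left_map_simps [simp]:
  "left_map f 0 = 0" "left_map f (frag_of (x, y)) = frag_of (f x, y)"
  "left_map f (z + w) = left_map f z + left_map f w"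
  "left_map f (z - w) = left_map f z - left_map f w"
  by (simp_all add: left_map_def frag_extend_add frag_extend_diff)

lemma keys_frag_extend_subset:
  assumes "Poly_Mapping.keys z \<subseteq> X" "\<And>p. p \<in> X \<Longrightarrow> Poly_Mapping.keys (\<phi> p) \<subseteq> Y"
  shows "Poly_Mapping.keys (frag_extend \<phi> z) \<subseteq> Y"
  using keys_frag_extend[of \<phi> z] assms by blast

lemma keys_left_map:
  assumes "Poly_Mapping.keys z \<subseteq> X \<times> Y" "\<And>x. x \<in> X \<Longrightarrow> f x \<in> X'"
  shows "Poly_Mapping.keys (left_map f z) \<subseteq> X' \<times> Y"
  unfolding left_map_def by (rule keys_frag_extend_subset[OF assms(1)]) (auto simp: assms(2))

locale tensor_modules = M: module R M + N: module R N for R M N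
begin

abbreviation eq (infix "\<simeq>" 50) where "z \<simeq> w \<equiv> tensor_eq R M N z w"

lemma tensor_rels_subset: "tensor_rels R M N \<subseteq> carrier (tensor_free M N)"
proof -
  show ?thesis
    by (auto simp: tensor_rels_def dest!: subsetD[OF keys_diff])
qed

lemma subgroup_tensor_null: "subgroup (tensor_null R M N) (tensor_free M N)"
  unfolding tensor_null_def
  by (rule group.generate_is_subgroup[OF group_free_Abelian_group tensor_rels_subset])

lemma tensor_null_zero: "0 \<in> tensor_null R M N"
  using subgroup.one_closed[OF subgroup_tensor_null] by simp

lemma tensor_null_add:
  "z \<in> tensor_null R M N \<Longrightarrow> w \<in> tensor_null R M N \<Longrightarrow> z + w \<in> tensor_null R M N"
  using subgroup.m_closed[OF subgroup_tensor_null] by simp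

lemma tensor_null_uminus: "z \<in> tensor_null R M N \<Longrightarrow> - z \<in> tensor_null R M N"
  using subgroup.m_inv_closed[OF subgroup_tensor_null, of z]
    subgroup.mem_carrier[OF subgroup_tensor_null, of z] by simp

lemma eq_refl [simp]: "z \<simeq> z"
  by (simp add: tensor_eq_def tensor_null_zero)

lemma eq_sym: "z \<simeq> w \<Longrightarrow> w \<simeq> z"
  using tensor_null_uminus[of "z - w"] by (simp add: tensor_eq_def)

lemma eq_trans [trans]: "z \<simeq> w \<Longrightarrow> w \<simeq> v \<Longrightarrow> z \<simeq> v"
  using tensor_null_add[of "z - w" "w - v"] by (simp add: tensor_eq_def)

lemma eq_add: "z \<simeq> w \<Longrightarrow> z' \<simeq> w' \<Longrightarrow> z + z' \<simeq> w + w'"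
  using tensor_null_add[of "z - w" "z' - w'"] by (simp add: tensor_eq_def algebra_simps)

lemma eq_diff: "z \<simeq> w \<Longrightarrow> z' \<simeq> w' \<Longrightarrow> z - z' \<simeq> w - w'"
  using eq_add[of z w "- z'" "- w'"] tensor_null_uminus[of "z' - w'"]
  by (simp add: tensor_eq_def algebra_simps)

lemma eq_add_left:
  "x \<in> carrier M \<Longrightarrow> x' \<in> carrier M \<Longrightarrow> y \<in> carrier N \<Longrightarrow>
    frag_of (x \<oplus>\<^bsub>M\<^esub> x', y) \<simeq> frag_of (x, y) + frag_of (x', y)"
  unfolding tensor_eq_def tensor_null_def
  by (rule generate.incl) (auto simp: tensor_rels_def diff_diff_eq)

lemma eq_add_right:
  "x \<in> carrier M \<Longrightarrow> y \<in> carrier N \<Longrightarrow> y' \<in> carrier N \<Longrightarrow>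
    frag_of (x, y \<oplus>\<^bsub>N\<^esub> y') \<simeq> frag_of (x, y) + frag_of (x, y')"
  unfolding tensor_eq_def tensor_null_def
  by (rule generate.incl) (auto simp: tensor_rels_def diff_diff_eq)

lemma eq_smult:
  "r \<in> carrier R \<Longrightarrow> x \<in> carrier M \<Longrightarrow> y \<in> carrier N \<Longrightarrow>
    frag_of (r \<odot>\<^bsub>M\<^esub> x, y) \<simeq> frag_of (x, r \<odot>\<^bsub>N\<^esub> y)"
  unfolding tensor_eq_def tensor_null_def
  by (rule generate.incl) (auto simp: tensor_rels_def)

text \<open>
  Additivity applied to \<open>0 + 0 = 0\<close> exhibits \<open>- (0 \<otimes> y)\<close> as one of the defining relations.
\<close>

lemma eq_zero_left:
  assumes "y \<in> carrier N"
  shows "frag_of (\<zero>\<^bsub>M\<^esub>, y) \<simeq> 0"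
  using eq_add_left[of "\<zero>\<^bsub>M\<^esub>" "\<zero>\<^bsub>M\<^esub>" y] assms
    tensor_null_uminus[of "- frag_of (\<zero>\<^bsub>M\<^esub>, y)"] by (simp add: tensor_eq_def)

text \<open>
  Congruence is compatible with differences, so identities between additive maps into a tensor
  product need to be verified on pairs only.
\<close>

lemma eq_additive_maps:
  fixes h h' :: "('k \<Rightarrow>\<^sub>0 int) \<Rightarrow> _"
  assumes "Poly_Mapping.keys z \<subseteq> X"
    and "\<And>v w. h (v - w) = h v - h w" "\<And>v w. h' (v - w) = h' v - h' w"
    and "\<And>p. p \<in> X \<Longrightarrow> h (frag_of p) \<simeq> h' (frag_of p)"
  shows "h z \<simeq> h' z"
  using assms(1)
proof (induction z rule: frag_induction)
  case zero
  show ?case using assms(2,3)[of 0 0] by simp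
qed (auto simp: assms intro: eq_diff)

lemma eq_class_iff: "tensor_class R M N z = tensor_class R M N w \<longleftrightarrow> z \<simeq> w"
proof -
  have "tensor_class R M N z = {v. v \<simeq> z}" for z
    by (force simp: tensor_class_def r_coset_def tensor_eq_def)
  then show ?thesis
    by (auto intro: eq_trans eq_sym)
qed

lemma carrier_tensor_product:
  "carrier (tensor_product R M N)
    = tensor_class R M N ` {z. Poly_Mapping.keys z \<subseteq> carrier M \<times> carrier N}"
  by (auto simp: tensor_product_def FactGroup_def RCOSETS_def tensor_class_def)

lemma zero_tensor_product: "\<zero>\<^bsub>tensor_product R M N\<^esub> = tensor_class R M N 0"
  by (auto simp: tensor_product_def FactGroup_def tensor_class_def r_coset_def)

lemma scalar_linear_map: "r \<in> carrier R \<Longrightarrow> (\<lambda>x. r \<odot>\<^bsub>M\<^esub> x) \<in> linear_maps R M M"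
  by (auto simp: linear_maps_def hom_def M.smult_r_distr M.smult_assoc1[symmetric] M.m_comm)

end

lemma linear_maps_closed: "f \<in> linear_maps R M N \<Longrightarrow> x \<in> carrier M \<Longrightarrow> f x \<in> carrier N"
  by (auto simp: linear_maps_def hom_def)

lemma linear_maps_add:
  "f \<in> linear_maps R M N \<Longrightarrow> x \<in> carrier M \<Longrightarrow> y \<in> carrier M \<Longrightarrow> f (x \<oplus>\<^bsub>M\<^esub> y) = f x \<oplus>\<^bsub>N\<^esub> f y"
  by (auto simp: linear_maps_def hom_def)

lemma linear_maps_smult:
  "f \<in> linear_maps R M N \<Longrightarrow> r \<in> carrier R \<Longrightarrow> x \<in> carrier M \<Longrightarrow> f (r \<odot>\<^bsub>M\<^esub> x) = r \<odot>\<^bsub>N\<^esub> f x"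
  by (auto simp: linear_maps_def)

text \<open>
  The universal property of the tensor product at the level of representatives: a function on pairs
  that respects the defining relations up to congruence extends additively to a map that respects
  congruence.
\<close>

lemma tensor_eq_lift:
  assumes "tensor_modules R M N" "tensor_modules R' M' N'"
    and "\<And>x x' y. x \<in> carrier M \<Longrightarrow> x' \<in> carrier M \<Longrightarrow> y \<in> carrier N \<Longrightarrow>
      tensor_eq R' M' N' (\<phi> (x \<oplus>\<^bsub>M\<^esub> x', y)) (\<phi> (x, y) + \<phi> (x', y))"
    and "\<And>x y y'. x \<in> carrier M \<Longrightarrow> y \<in> carrier N \<Longrightarrow> y' \<in> carrier N \<Longrightarrow>
      tensor_eq R' M' N' (\<phi> (x, y \<oplus>\<^bsub>N\<^esub> y')) (\<phi> (x, y) + \<phi> (x, y'))"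
    and "\<And>r x y. r \<in> carrier R \<Longrightarrow> x \<in> carrier M \<Longrightarrow> y \<in> carrier N \<Longrightarrow>
      tensor_eq R' M' N' (\<phi> (r \<odot>\<^bsub>M\<^esub> x, y)) (\<phi> (x, r \<odot>\<^bsub>N\<^esub> y))"
    and "tensor_eq R M N z w"
  shows "tensor_eq R' M' N' (frag_extend \<phi> z) (frag_extend \<phi> w)"
proof -
  interpret T: tensor_modules R M N by fact
  interpret T': tensor_modules R' M' N' by fact
  have rels: "frag_extend \<phi> v \<in> tensor_null R' M' N'" if "v \<in> tensor_rels R M N" for v
    using that assms(3-5)
    by (auto simp: tensor_rels_def frag_extend_diff frag_extend_add tensor_eq_def diff_diff_eq)
  have "frag_extend \<phi> v \<in> tensor_null R' M' N'" if "v \<in> tensor_null R M N" for v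
    using that unfolding tensor_null_def[of R M N]
  proof (induction v rule: generate.induct)
    case (inv h)
    then have "Poly_Mapping.keys h \<subseteq> carrier M \<times> carrier N"
      using subsetD[OF T.tensor_rels_subset, of h] by simp
    then show ?case
      using inv by (simp add: frag_extend_minus rels T'.tensor_null_uminus)
  qed (simp_all add: T'.tensor_null_zero T'.tensor_null_add rels frag_extend_add)
  from this[of "z - w"] assms(6) show ?thesis
    by (simp add: tensor_eq_def frag_extend_diff)
qed

lemma tensor_eq_left_map:
  assumes "tensor_modules R M N" "tensor_modules R M' N" "f \<in> linear_maps R M M'"
    and "tensor_eq R M N z w"
  shows "tensor_eq R M' N (left_map f z) (left_map f w)"
proof -
  interpret T': tensor_modules R M' N by fact
  show ?thesis
    unfolding left_map_def
    by (rule tensor_eq_lift[OF assms(1,2) _ _ _ assms(4)])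
       (auto simp: linear_maps_add[OF assms(3)] linear_maps_smult[OF assms(3)]
          linear_maps_closed[OF assms(3)] T'.eq_add_left T'.eq_add_right T'.eq_smult)
qed

lemma tensor_map_class:
  assumes "tensor_modules R M N" "tensor_modules R M' N" "f \<in> linear_maps R M M'"
  shows "tensor_map R M' N f (tensor_class R M N z) = tensor_class R M' N (left_map f z)"
proof -
  interpret T: tensor_modules R M N by fact
  interpret T': tensor_modules R M' N by fact
  have *: "left_map f v \<in> tensor_null R M' N" if "v \<in> tensor_null R M N" for v
    using tensor_eq_left_map[OF assms, of v 0] that by (simp add: tensor_eq_def)
  have "tensor_map R M' N f (tensor_class R M N z)
      = {k + (left_map f v + left_map f z) | k v. k \<in> tensor_null R M' N \<and> v \<in> tensor_null R M N}"
    unfolding tensor_map_def left_map_def[symmetric]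
    by (auto simp: set_mult_def tensor_class_def r_coset_def)
  also have "\<dots> = {k + left_map f z | k. k \<in> tensor_null R M' N}"
  proof (intro equalityI subsetI; clarify)
    fix k v assume "k \<in> tensor_null R M' N" "v \<in> tensor_null R M N"
    then show "\<exists>k'. k + (left_map f v + left_map f z) = k' + left_map f z \<and> k' \<in> tensor_null R M' N"
      by (intro exI[of _ "k + left_map f v"]) (simp add: * T'.tensor_null_add add.assoc)
  next
    fix k assume "k \<in> tensor_null R M' N"
    then show "\<exists>k' v. k + left_map f z = k' + (left_map f v + left_map f z) \<and>
        k' \<in> tensor_null R M' N \<and> v \<in> tensor_null R M N"
      by (intro exI[of _ k] exI[of _ 0]) (simp add: T.tensor_null_zero)
  qed
  also have "\<dots> = tensor_class R M' N (left_map f z)"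
    by (auto simp: tensor_class_def r_coset_def)
  finally show ?thesis .
qed

lemma smult_tensor_class:
  assumes "tensor_modules R M N" "r \<in> carrier R"
  shows "r \<odot>\<^bsub>tensor_product R M N\<^esub> tensor_class R M N z = tensor_class R M N (left_map (\<lambda>x. r \<odot>\<^bsub>M\<^esub> x) z)"
  using tensor_map_class[OF assms(1,1) tensor_modules.scalar_linear_map[OF assms]]
  by (simp add: tensor_product_def)

abbreviation tensor_reps :: "('s, 'a, 'y) module_scheme \<Rightarrow> ('r, 'b, 'z) module_scheme \<Rightarrow> ('a \<times> 'b \<Rightarrow>\<^sub>0 int) set"
  where "tensor_reps M N \<equiv> {z. Poly_Mapping.keys z \<subseteq> carrier M \<times> carrier N}"

text \<open>
  Kernels and images of induced maps are now described by representatives, which turns both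
  exactness notions into statements about congruences.
\<close>

lemma a_kernel_tensor_map:
  assumes "tensor_modules R M N" "tensor_modules R M' N" "f \<in> linear_maps R M M'"
  shows "a_kernel (tensor_product R M N) (tensor_product R M' N) (tensor_map R M' N f)
    = tensor_class R M N ` {z \<in> tensor_reps M N. tensor_eq R M' N (left_map f z) 0}"
proof -
  have "tensor_map R M' N f (tensor_class R M N z) = \<zero>\<^bsub>tensor_product R M' N\<^esub>
      \<longleftrightarrow> tensor_eq R M' N (left_map f z) 0" for z
    by (simp only: tensor_modules.zero_tensor_product[OF assms(2)] tensor_map_class[OF assms]
        tensor_modules.eq_class_iff[OF assms(2)])
  then show ?thesis
    unfolding a_kernel_def' tensor_modules.carrier_tensor_product[OF assms(1)] by blast
qed

lemma image_tensor_map: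
  assumes "tensor_modules R M N" "tensor_modules R M' N" "f \<in> linear_maps R M M'"
  shows "tensor_map R M' N f ` carrier (tensor_product R M N) = tensor_class R M' N ` left_map f ` tensor_reps M N"
  by (simp only: tensor_modules.carrier_tensor_product[OF assms(1)] image_image tensor_map_class[OF assms])

lemma a_kernel_zero_module: "a_kernel M zero_module (\<lambda>_. ()) = carrier M"
  by (simp add: a_kernel_def' zero_module_def)

lemma carrier_zero_module [simp]: "carrier zero_module = {()}"
  by (simp add: zero_module_def)

locale tensor_sequence =
  A: tensor_modules R A F + B: tensor_modules R B F + C: tensor_modules R C F for R A B C F +
  fixes f g
  assumes f: "f \<in> linear_maps R A B" and g: "g \<in> linear_maps R B C"
begin

lemma short_exactI:
  assumes left: "\<And>z. z \<in> tensor_reps A F \<Longrightarrow> tensor_eq R B F (left_map f z) 0 \<Longrightarrow> tensor_eq R A F z 0"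
    and complex: "\<And>w. w \<in> tensor_reps A F \<Longrightarrow> tensor_eq R C F (left_map g (left_map f w)) 0"
    and middle: "\<And>z. z \<in> tensor_reps B F \<Longrightarrow> tensor_eq R C F (left_map g z) 0 \<Longrightarrow>
      \<exists>w\<in>tensor_reps A F. tensor_eq R B F z (left_map f w)"
    and right: "\<And>z. z \<in> tensor_reps C F \<Longrightarrow> \<exists>w\<in>tensor_reps B F. tensor_eq R C F z (left_map g w)"
  shows "short_exact (tensor_product R A F) (tensor_product R B F) (tensor_product R C F)
    (tensor_map R B F f) (tensor_map R C F g)"
proof -
  have "exact_at zero_module (tensor_product R A F) (tensor_product R B F)
      (\<lambda>_. \<zero>\<^bsub>tensor_product R A F\<^esub>) (tensor_map R B F f)"
  proof -
    have "tensor_class R A F ` {z \<in> tensor_reps A F. tensor_eq R B F (left_map f z) 0} = {tensor_class R A F 0}"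
    proof (intro equalityI subsetI)
      fix X assume "X \<in> tensor_class R A F ` {z \<in> tensor_reps A F. tensor_eq R B F (left_map f z) 0}"
      then obtain z where "X = tensor_class R A F z" "z \<in> tensor_reps A F" "tensor_eq R B F (left_map f z) 0"
        by auto
      with left[of z] show "X \<in> {tensor_class R A F 0}"
        by (simp only: A.eq_class_iff singleton_iff)
    next
      fix X assume "X \<in> {tensor_class R A F 0}"
      then show "X \<in> tensor_class R A F ` {z \<in> tensor_reps A F. tensor_eq R B F (left_map f z) 0}"
        by (intro image_eqI[of _ _ 0]) auto
    qed
    then show ?thesis
      unfolding exact_at_def a_kernel_tensor_map[OF A.tensor_modules_axioms B.tensor_modules_axioms f]
      by (simp add: A.zero_tensor_product)
  qed
  moreover have "exact_at (tensor_product R A F) (tensor_product R B F) (tensor_product R C F)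
      (tensor_map R B F f) (tensor_map R C F g)"
    unfolding exact_at_def image_tensor_map[OF A.tensor_modules_axioms B.tensor_modules_axioms f]
      a_kernel_tensor_map[OF B.tensor_modules_axioms C.tensor_modules_axioms g]
  proof (intro equalityI subsetI)
    fix X assume "X \<in> tensor_class R B F ` left_map f ` tensor_reps A F"
    then obtain w where "w \<in> tensor_reps A F" "X = tensor_class R B F (left_map f w)"
      by auto
    then show "X \<in> tensor_class R B F ` {z \<in> tensor_reps B F. tensor_eq R C F (left_map g z) 0}"
      using complex[of w] keys_left_map[of w "carrier A" "carrier F" f "carrier B"]
        linear_maps_closed[OF f] by auto
  next
    fix X assume "X \<in> tensor_class R B F ` {z \<in> tensor_reps B F. tensor_eq R C F (left_map g z) 0}"
    then obtain z where "X = tensor_class R B F z" "z \<in> tensor_reps B F" "tensor_eq R C F (left_map g z) 0"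
      by auto
    with middle[of z] show "X \<in> tensor_class R B F ` left_map f ` tensor_reps A F"
      by (metis (no_types, lifting) B.eq_class_iff imageI)
  qed
  moreover have "exact_at (tensor_product R B F) (tensor_product R C F) zero_module
      (tensor_map R C F g) (\<lambda>_. ())"
    unfolding exact_at_def image_tensor_map[OF B.tensor_modules_axioms C.tensor_modules_axioms g]
      a_kernel_zero_module C.carrier_tensor_product
  proof (intro equalityI subsetI)
    fix X assume "X \<in> tensor_class R C F ` left_map g ` tensor_reps B F"
    then show "X \<in> tensor_class R C F ` tensor_reps C F"
      using keys_left_map[of _ "carrier B" "carrier F" g "carrier C"] linear_maps_closed[OF g] by auto
  next
    fix X assume "X \<in> tensor_class R C F ` tensor_reps C F"
    then obtain z where "X = tensor_class R C F z" "z \<in> tensor_reps C F"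
      by auto
    with right[of z] show "X \<in> tensor_class R C F ` left_map g ` tensor_reps B F"
      by (metis (no_types, lifting) C.eq_class_iff imageI)
  qed
  ultimately show ?thesis
    by (simp add: short_exact_def)
qed

lemma u_S_short_exactD:
  assumes "u_S_short_exact S (tensor_product R A F) (tensor_product R B F) (tensor_product R C F)
      (tensor_map R B F f) (tensor_map R C F g)"
    and S: "S \<subseteq> carrier R"
  shows "\<exists>s\<in>S. \<forall>z\<in>tensor_reps A F. tensor_eq R B F (left_map f z) 0 \<longrightarrow>
      tensor_eq R A F (left_map (\<lambda>x. s \<odot>\<^bsub>A\<^esub> x) z) 0"
    and "\<exists>s\<in>S. \<forall>z\<in>tensor_reps B F. tensor_eq R C F (left_map g z) 0 \<longrightarrow>
      (\<exists>w\<in>tensor_reps A F. tensor_eq R B F (left_map (\<lambda>x. s \<odot>\<^bsub>B\<^esub> x) z) (left_map f w))"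
    and "\<exists>s\<in>S. \<forall>z\<in>tensor_reps C F.
      \<exists>w\<in>tensor_reps B F. tensor_eq R C F (left_map (\<lambda>x. s \<odot>\<^bsub>C\<^esub> x) z) (left_map g w)"
proof -
  note exact = assms(1)[unfolded u_S_short_exact_def u_S_exact_at_def
      a_kernel_tensor_map[OF A.tensor_modules_axioms B.tensor_modules_axioms f]
      a_kernel_tensor_map[OF B.tensor_modules_axioms C.tensor_modules_axioms g]
      image_tensor_map[OF A.tensor_modules_axioms B.tensor_modules_axioms f]
      image_tensor_map[OF B.tensor_modules_axioms C.tensor_modules_axioms g]
      a_kernel_zero_module C.carrier_tensor_product A.zero_tensor_product carrier_zero_module
      image_insert image_empty]
  from exact obtain s where s: "s \<in> S"
    "(\<lambda>x. s \<odot>\<^bsub>tensor_product R A F\<^esub> x) ` tensor_class R A F ` {z \<in> tensor_reps A F. tensor_eq R B F (left_map f z) 0}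
      \<subseteq> {tensor_class R A F 0}"
    by (elim conjE bexE)
  from exact obtain t where t: "t \<in> S"
    "(\<lambda>x. t \<odot>\<^bsub>tensor_product R B F\<^esub> x) ` tensor_class R B F ` {z \<in> tensor_reps B F. tensor_eq R C F (left_map g z) 0}
      \<subseteq> tensor_class R B F ` left_map f ` tensor_reps A F"
    by (elim conjE bexE)
  from exact obtain u where u: "u \<in> S"
    "(\<lambda>x. u \<odot>\<^bsub>tensor_product R C F\<^esub> x) ` tensor_class R C F ` tensor_reps C F
      \<subseteq> tensor_class R C F ` left_map g ` tensor_reps B F"
    by (elim conjE bexE)
  note smult = smult_tensor_class[OF A.tensor_modules_axioms] smult_tensor_class[OF B.tensor_modules_axioms]
    smult_tensor_class[OF C.tensor_modules_axioms]
  have R: "s \<in> carrier R" "t \<in> carrier R" "u \<in> carrier R"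
    using s(1) t(1) u(1) S by auto
  show "\<exists>s\<in>S. \<forall>z\<in>tensor_reps A F. tensor_eq R B F (left_map f z) 0 \<longrightarrow>
      tensor_eq R A F (left_map (\<lambda>x. s \<odot>\<^bsub>A\<^esub> x) z) 0"
  proof (intro bexI[OF _ s(1)] ballI impI)
    fix z assume "z \<in> tensor_reps A F" "tensor_eq R B F (left_map f z) 0"
    then have "s \<odot>\<^bsub>tensor_product R A F\<^esub> tensor_class R A F z = tensor_class R A F 0"
      using s(2) by (blast intro: CollectI)
    then show "tensor_eq R A F (left_map (\<lambda>x. s \<odot>\<^bsub>A\<^esub> x) z) 0"
      by (simp add: smult R A.eq_class_iff)
  qed
  show "\<exists>s\<in>S. \<forall>z\<in>tensor_reps B F. tensor_eq R C F (left_map g z) 0 \<longrightarrow>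
      (\<exists>w\<in>tensor_reps A F. tensor_eq R B F (left_map (\<lambda>x. s \<odot>\<^bsub>B\<^esub> x) z) (left_map f w))"
  proof (intro bexI[OF _ t(1)] ballI impI)
    fix z assume "z \<in> tensor_reps B F" "tensor_eq R C F (left_map g z) 0"
    then have "t \<odot>\<^bsub>tensor_product R B F\<^esub> tensor_class R B F z \<in> tensor_class R B F ` left_map f ` tensor_reps A F"
      using t(2) by (blast intro: CollectI)
    then show "\<exists>w\<in>tensor_reps A F. tensor_eq R B F (left_map (\<lambda>x. t \<odot>\<^bsub>B\<^esub> x) z) (left_map f w)"
      by (auto simp: smult R B.eq_class_iff)
  qed
  show "\<exists>s\<in>S. \<forall>z\<in>tensor_reps C F.
      \<exists>w\<in>tensor_reps B F. tensor_eq R C F (left_map (\<lambda>x. s \<odot>\<^bsub>C\<^esub> x) z) (left_map g w)"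
  proof (intro bexI[OF _ u(1)] ballI)
    fix z assume "z \<in> tensor_reps C F"
    then have "u \<odot>\<^bsub>tensor_product R C F\<^esub> tensor_class R C F z \<in> tensor_class R C F ` left_map g ` tensor_reps B F"
      using u(2) by (blast intro: CollectI)
    then show "\<exists>w\<in>tensor_reps B F. tensor_eq R C F (left_map (\<lambda>x. u \<odot>\<^bsub>C\<^esub> x) z) (left_map g w)"
      by (auto simp: smult R C.eq_class_iff)
  qed
qed

end


section \<open>Localizing the second tensor factor\<close>

definition scalar_frac :: "('r, 'x) ring_scheme \<Rightarrow> 'r set \<Rightarrow> 'r \<Rightarrow> ('r \<times> 'r) set"
  where "scalar_frac R S r = ring_frac R S r \<one>\<^bsub>R\<^esub>"

definition localize_tensor ::
  "('r, 'x) ring_scheme \<Rightarrow> 'r set \<Rightarrow> ('r, 'f, 'y) module_scheme \<Rightarrow>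
   ('a \<times> 'f \<Rightarrow>\<^sub>0 int) \<Rightarrow> ('a \<times> ('f \<times> 'r) set \<Rightarrow>\<^sub>0 int)"
  where "localize_tensor R S F = frag_extend (\<lambda>(a, x). frag_of (a, module_frac F S x \<one>\<^bsub>R\<^esub>))"

text \<open>
  A fraction has no preferred numerator and denominator, so a map back from the localization
  must choose them; up to congruence the choice turns out to be irrelevant.
\<close>

definition representative :: "('r, 'f, 'y) module_scheme \<Rightarrow> 'r set \<Rightarrow> ('f \<times> 'r) set \<Rightarrow> 'f \<times> 'r"
  where "representative F S X = (SOME p. p \<in> carrier F \<times> S \<and> X = module_frac F S (fst p) (snd p))"

text \<open>
  The map \<open>(a, x / s) \<mapsto> (1 / s) a \<otimes> x\<close>.
\<close>

definition delocalize_generator ::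
  "('r, 'x) ring_scheme \<Rightarrow> 'r set \<Rightarrow> ('r, 'f, 'y) module_scheme \<Rightarrow> (('r \<times> 'r) set, 'a, 'z) module_scheme \<Rightarrow>
   'a \<times> ('f \<times> 'r) set \<Rightarrow> ('a \<times> 'f \<Rightarrow>\<^sub>0 int)"
  where "delocalize_generator R S F A = (\<lambda>(a, X). case representative F S X of
    (x, s) \<Rightarrow> frag_of (ring_frac R S \<one>\<^bsub>R\<^esub> s \<odot>\<^bsub>A\<^esub> a, x))"

definition delocalize_tensor ::
  "('r, 'x) ring_scheme \<Rightarrow> 'r set \<Rightarrow> ('r, 'f, 'y) module_scheme \<Rightarrow> (('r \<times> 'r) set, 'a, 'z) module_scheme \<Rightarrow>
   ('a \<times> ('f \<times> 'r) set \<Rightarrow>\<^sub>0 int) \<Rightarrow> ('a \<times> 'f \<Rightarrow>\<^sub>0 int)"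
  where "delocalize_tensor R S F A = frag_extend (delocalize_generator R S F A)"

lemma (in localization) scalar_frac_ring_hom: "scalar_frac R S \<in> ring_hom R (loc_ring R S)"
  by (rule ring_hom_memI)
     (auto simp: scalar_frac_def mult_ring_frac add_ring_frac loc_ring_simps(5))

text \<open>
  Over the localized ring, \<open>A\<close> is the given module, and \<open>AR\<close> is the same additive group with scalars
  restricted along \<open>r \<mapsto> r / 1\<close>.  The comparison is between \<open>AR \<otimes> F\<close> over \<open>R\<close> and \<open>A \<otimes> FS\<close>
  over \<open>RS\<close>.
\<close>

locale localized_tensor = localization R F S + A: module "loc_ring R S" A
  for R (structure) and F (structure) and S and A
begin

abbreviation "RS \<equiv> loc_ring R S"
abbreviation "FS \<equiv> loc_module R S F"
abbreviation "AR \<equiv> restrict_scalars (scalar_frac R S) A"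

lemma module_restricted: "module R AR"
  by (rule module_restrict_scalars[OF R.is_cring A.module_axioms scalar_frac_ring_hom])

sublocale restricted: tensor_modules R AR F
  by (intro tensor_modules.intro module_axioms module_restricted)

sublocale localized: tensor_modules RS A FS
  by (intro tensor_modules.intro module_loc_module A.module_axioms)

lemma scalar_frac_smult_frac:
  assumes "a \<in> carrier A" "s \<in> S" "u \<in> S"
  shows "scalar_frac R S u \<odot>\<^bsub>A\<^esub> (ring_frac R S \<one> (u \<otimes> s) \<odot>\<^bsub>A\<^esub> a) = ring_frac R S \<one> s \<odot>\<^bsub>A\<^esub> a"
  using assms ring_frac_cancel[of \<one> s u]
  by (simp add: scalar_frac_def A.smult_assoc1[symmetric] mult_ring_frac)

lemma ring_frac_one_smult: "a \<in> carrier A \<Longrightarrow> ring_frac R S \<one> \<one> \<odot>\<^bsub>A\<^esub> a = a"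
  using A.smult_one[of a] by (simp add: loc_ring_simps(5))

lemma frac_smult_scalar_frac:
  assumes "a \<in> carrier A" "s \<in> S"
  shows "ring_frac R S \<one> s \<odot>\<^bsub>A\<^esub> (scalar_frac R S s \<odot>\<^bsub>A\<^esub> a) = a"
  using assms ring_frac_cancel[of \<one> \<one> s]
  by (simp add: scalar_frac_def A.smult_assoc1[symmetric] mult_ring_frac ring_frac_one_smult)

text \<open>
  Since \<open>1 / s = u (1 / (u s))\<close> in the localized ring, balancedness over \<open>R\<close> moves the factor \<open>u\<close> to the
  other side of the tensor.
\<close>

lemma eq_cancel:
  assumes "a \<in> carrier A" "x \<in> carrier F" "s \<in> S" "u \<in> S"
  shows "tensor_eq R AR F (frag_of (ring_frac R S \<one> (u \<otimes> s) \<odot>\<^bsub>A\<^esub> a, u \<odot>\<^bsub>F\<^esub> x))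
    (frag_of (ring_frac R S \<one> s \<odot>\<^bsub>A\<^esub> a, x))"
  using restricted.eq_smult[of u "ring_frac R S \<one> (u \<otimes> s) \<odot>\<^bsub>A\<^esub> a" x] assms
  by (auto simp: scalar_frac_smult_frac intro: restricted.eq_sym)

text \<open>
  If \<open>u t x = u s y\<close>, then both tensors reduce to the common denominator \<open>u s t\<close>, where the second
  components agree.
\<close>

lemma eq_same_frac:
  assumes "a \<in> carrier A" "x \<in> carrier F" "y \<in> carrier F" "s \<in> S" "t \<in> S"
    and "module_frac F S x s = module_frac F S y t"
  shows "tensor_eq R AR F (frag_of (ring_frac R S \<one> s \<odot>\<^bsub>A\<^esub> a, x)) (frag_of (ring_frac R S \<one> t \<odot>\<^bsub>A\<^esub> a, y))"
proof -
  obtain u where u: "u \<in> S" "u \<odot>\<^bsub>F\<^esub> (t \<odot>\<^bsub>F\<^esub> x) = u \<odot>\<^bsub>F\<^esub> (s \<odot>\<^bsub>F\<^esub> y)"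
    using assms by (auto elim: frac_eqE)
  have "tensor_eq R AR F (frag_of (ring_frac R S \<one> s \<odot>\<^bsub>A\<^esub> a, x))
      (frag_of (ring_frac R S \<one> ((u \<otimes> t) \<otimes> s) \<odot>\<^bsub>A\<^esub> a, (u \<otimes> t) \<odot>\<^bsub>F\<^esub> x))"
    by (rule restricted.eq_sym, rule eq_cancel) (use assms u in auto)
  also have "((u \<otimes> t) \<otimes> s) = (u \<otimes> s) \<otimes> t"
    using assms u by (simp add: m_ac)
  also have "(u \<otimes> t) \<odot>\<^bsub>F\<^esub> x = (u \<otimes> s) \<odot>\<^bsub>F\<^esub> y"
    using assms u by (simp add: smult_assoc1)
  also have "tensor_eq R AR F (frag_of (ring_frac R S \<one> ((u \<otimes> s) \<otimes> t) \<odot>\<^bsub>A\<^esub> a, (u \<otimes> s) \<odot>\<^bsub>F\<^esub> y))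
      (frag_of (ring_frac R S \<one> t \<odot>\<^bsub>A\<^esub> a, y))"
    by (rule eq_cancel) (use assms u in auto)
  finally show ?thesis .
qed

lemma representative:
  assumes "X \<in> carrier FS"
  obtains x s where "representative F S X = (x, s)" "x \<in> carrier F" "s \<in> S" "X = module_frac F S x s"
proof -
  have "\<exists>p. p \<in> carrier F \<times> S \<and> X = module_frac F S (fst p) (snd p)"
    using assms by (auto elim!: fracE)
  from someI_ex[OF this] show thesis
    by (intro that[of "fst (representative F S X)" "snd (representative F S X)"])
       (auto simp: representative_def)
qed

lemma delocalize_generator_frac:
  assumes "a \<in> carrier A" "x \<in> carrier F" "s \<in> S"
  shows "tensor_eq R AR F (delocalize_generator R S F A (a, module_frac F S x s))
    (frag_of (ring_frac R S \<one> s \<odot>\<^bsub>A\<^esub> a, x))"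
proof -
  obtain y t where "representative F S (module_frac F S x s) = (y, t)" "y \<in> carrier F" "t \<in> S"
    "module_frac F S x s = module_frac F S y t"
    by (rule representative[OF frac_closed[OF assms(2,3)]])
  then show ?thesis
    using assms eq_same_frac[of a y x t s] by (simp add: delocalize_generator_def)
qed

lemma keys_localize_tensor:
  "z \<in> tensor_reps A F \<Longrightarrow> localize_tensor R S F z \<in> tensor_reps A FS"
  unfolding localize_tensor_def
  by (auto dest!: subsetD[OF keys_frag_extend_subset[of z "carrier A \<times> carrier F"
        "\<lambda>(a, x). frag_of (a, module_frac F S x \<one>)" "carrier A \<times> carrier FS"], rotated -1])

lemma keys_delocalize_tensor:
  assumes "z \<in> tensor_reps A FS"
  shows "delocalize_tensor R S F A z \<in> tensor_reps A F"
proof -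
  have "Poly_Mapping.keys (delocalize_generator R S F A p) \<subseteq> carrier A \<times> carrier F"
    if "p \<in> carrier A \<times> carrier FS" for p
    using that by (auto simp: delocalize_generator_def elim!: representative)
  then show ?thesis
    using assms by (simp add: delocalize_tensor_def) (rule keys_frag_extend_subset)
qed

text \<open>
  The map \<open>a \<otimes> x \<mapsto> a \<otimes> (x / 1)\<close> is well defined: \<open>x \<mapsto> x / 1\<close> is additive, and restricted scalars act
  through \<open>r / 1\<close> on both sides.
\<close>

lemma localize_tensor_eq:
  assumes "tensor_eq R AR F z w"
  shows "tensor_eq RS A FS (localize_tensor R S F z) (localize_tensor R S F w)"
proof -
  have add: "module_frac F S (x \<oplus>\<^bsub>F\<^esub> y) \<one> = module_frac F S x \<one> \<oplus>\<^bsub>FS\<^esub> module_frac F S y \<one>"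
    if "x \<in> carrier F" "y \<in> carrier F" for x y
    using that by (simp add: add_frac)
  have smult: "module_frac F S (r \<odot>\<^bsub>F\<^esub> x) \<one> = scalar_frac R S r \<odot>\<^bsub>FS\<^esub> module_frac F S x \<one>"
    if "r \<in> carrier R" "x \<in> carrier F" for r x
    using that by (simp add: scalar_frac_def smult_frac)
  show ?thesis
    unfolding localize_tensor_def
    by (rule tensor_eq_lift[OF restricted.tensor_modules_axioms localized.tensor_modules_axioms _ _ _ assms])
       (auto simp: add smult localized.eq_add_left localized.eq_add_right
          ring_hom_closed[OF scalar_frac_ring_hom] intro!: localized.eq_smult)
qed

text \<open>
  The map \<open>a \<otimes> (x / s) \<mapsto> (1 / s) a \<otimes> x\<close> is well defined: additivity in the second argument is
  checked over a common denominator, and a scalar \<open>b / u\<close> contributes \<open>b\<close>, which balancedness over \<open>R\<close>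
  carries across, and \<open>1 / u\<close>, which joins \<open>1 / s\<close>.
\<close>

lemma delocalize_tensor_eq:
  assumes "tensor_eq RS A FS z w"
  shows "tensor_eq R AR F (delocalize_tensor R S F A z) (delocalize_tensor R S F A w)"
  unfolding delocalize_tensor_def
proof (rule tensor_eq_lift[OF localized.tensor_modules_axioms restricted.tensor_modules_axioms _ _ _ assms])
  fix a a' X assume "a \<in> carrier A" "a' \<in> carrier A" "X \<in> carrier FS"
  then show "tensor_eq R AR F (delocalize_generator R S F A (a \<oplus>\<^bsub>A\<^esub> a', X))
      (delocalize_generator R S F A (a, X) + delocalize_generator R S F A (a', X))"
    using restricted.eq_add_left
    by (auto elim!: representative simp: delocalize_generator_def A.smult_r_distr)
next
  fix a X Y assume *: "a \<in> carrier A" "X \<in> carrier FS" "Y \<in> carrier FS"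
  then obtain x s y t where XY: "x \<in> carrier F" "s \<in> S" "X = module_frac F S x s"
    "y \<in> carrier F" "t \<in> S" "Y = module_frac F S y t"
    by (auto elim!: fracE)
  let ?b = "ring_frac R S \<one> (s \<otimes> t) \<odot>\<^bsub>A\<^esub> a"
  have "tensor_eq R AR F (delocalize_generator R S F A (a, X \<oplus>\<^bsub>FS\<^esub> Y))
      (frag_of (?b, t \<odot>\<^bsub>F\<^esub> x \<oplus>\<^bsub>F\<^esub> s \<odot>\<^bsub>F\<^esub> y))"
    using * XY by (simp add: add_frac delocalize_generator_frac)
  also have "tensor_eq R AR F (frag_of (?b, t \<odot>\<^bsub>F\<^esub> x \<oplus>\<^bsub>F\<^esub> s \<odot>\<^bsub>F\<^esub> y))
      (frag_of (?b, t \<odot>\<^bsub>F\<^esub> x) + frag_of (?b, s \<odot>\<^bsub>F\<^esub> y))"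
    using * XY by (intro restricted.eq_add_right) auto
  also have "tensor_eq R AR F (frag_of (?b, t \<odot>\<^bsub>F\<^esub> x) + frag_of (?b, s \<odot>\<^bsub>F\<^esub> y))
      (frag_of (ring_frac R S \<one> s \<odot>\<^bsub>A\<^esub> a, x) + frag_of (ring_frac R S \<one> t \<odot>\<^bsub>A\<^esub> a, y))"
    using * XY eq_cancel[of a x s t] eq_cancel[of a y t s]
    by (intro restricted.eq_add) (simp_all add: m_comm)
  also have "tensor_eq R AR F \<dots>
      (delocalize_generator R S F A (a, X) + delocalize_generator R S F A (a, Y))"
    using * XY by (intro restricted.eq_sym[OF restricted.eq_add]) (simp_all add: delocalize_generator_frac)
  finally show "tensor_eq R AR F (delocalize_generator R S F A (a, X \<oplus>\<^bsub>FS\<^esub> Y))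
      (delocalize_generator R S F A (a, X) + delocalize_generator R S F A (a, Y))" .
next
  fix r a X assume *: "r \<in> carrier RS" "a \<in> carrier A" "X \<in> carrier FS"
  then obtain b u x s where rX: "b \<in> carrier R" "u \<in> S" "r = ring_frac R S b u"
    "x \<in> carrier F" "s \<in> S" "X = module_frac F S x s"
    by (auto elim!: fracE ring_fracE)
  let ?c = "ring_frac R S \<one> (u \<otimes> s) \<odot>\<^bsub>A\<^esub> a"
  have "tensor_eq R AR F (delocalize_generator R S F A (r \<odot>\<^bsub>A\<^esub> a, X))
      (frag_of (ring_frac R S \<one> s \<odot>\<^bsub>A\<^esub> (r \<odot>\<^bsub>A\<^esub> a), x))"
    using * rX by (simp add: delocalize_generator_frac)
  also have "ring_frac R S \<one> s \<odot>\<^bsub>A\<^esub> (r \<odot>\<^bsub>A\<^esub> a) = b \<odot>\<^bsub>AR\<^esub> ?c"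
    using * rX by (simp add: scalar_frac_def A.smult_assoc1[symmetric] mult_ring_frac m_ac)
  also have "tensor_eq R AR F (frag_of (b \<odot>\<^bsub>AR\<^esub> ?c, x)) (frag_of (?c, b \<odot>\<^bsub>F\<^esub> x))"
    using * rX by (intro restricted.eq_smult) auto
  also have "tensor_eq R AR F \<dots> (delocalize_generator R S F A (a, r \<odot>\<^bsub>FS\<^esub> X))"
    using * rX by - (rule restricted.eq_sym, simp add: smult_frac delocalize_generator_frac)
  finally show "tensor_eq R AR F (delocalize_generator R S F A (r \<odot>\<^bsub>A\<^esub> a, X))
      (delocalize_generator R S F A (a, r \<odot>\<^bsub>FS\<^esub> X))" .
qed

lemma localize_delocalize:
  assumes "z \<in> tensor_reps A FS"
  shows "tensor_eq RS A FS (localize_tensor R S F (delocalize_tensor R S F A z)) z"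
proof (rule localized.eq_additive_maps[where h = "\<lambda>z. localize_tensor R S F (delocalize_tensor R S F A z)"
        and h' = "\<lambda>z. z"])
  fix p assume "p \<in> carrier A \<times> carrier FS"
  then obtain a X where p: "p = (a, X)" "a \<in> carrier A" "X \<in> carrier FS"
    by auto
  then obtain x s where X: "representative F S X = (x, s)" "x \<in> carrier F" "s \<in> S" "X = module_frac F S x s"
    by (elim representative)
  then show "tensor_eq RS A FS (localize_tensor R S F (delocalize_tensor R S F A (frag_of p))) (frag_of p)"
    using p localized.eq_smult[of "ring_frac R S \<one> s" a "module_frac F S x \<one>"]
    by (simp add: localize_tensor_def delocalize_tensor_def delocalize_generator_def smult_frac)
qed (use assms in \<open>auto simp: localize_tensor_def delocalize_tensor_def frag_extend_diff\<close>)

end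

lemma left_map_localize_tensor:
  "left_map f (localize_tensor R S F z) = localize_tensor R S F (left_map f z)"
  by (induction z rule: frag_induction[OF subset_UNIV])
     (auto simp: localize_tensor_def left_map_def frag_extend_diff)

text \<open>
  Naturality holds on the nose because the numerator and denominator are chosen from the fraction
  alone, independently of the first component and of the module.
\<close>

lemma left_map_delocalize_tensor:
  assumes "localized_tensor R F S A" "f \<in> linear_maps (loc_ring R S) A B"
    and "Poly_Mapping.keys z \<subseteq> carrier A \<times> carrier (loc_module R S F)"
  shows "left_map f (delocalize_tensor R S F A z) = delocalize_tensor R S F B (left_map f z)"
  using assms(3)
proof (induction z rule: frag_induction)
  case (one p)
  interpret localized_tensor R F S A by fact
  from one obtain a X where p: "p = (a, X)" "a \<in> carrier A" "X \<in> carrier FS"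
    by auto
  then obtain x s where "representative F S X = (x, s)" "s \<in> S"
    by (elim representative)
  with p show ?case
    by (simp add: delocalize_tensor_def delocalize_generator_def linear_maps_smult[OF assms(2)])
qed (simp_all add: delocalize_tensor_def frag_extend_diff)

context localized_tensor
begin

lemma left_map_unscale:
  assumes "z \<in> tensor_reps A F" "s \<in> S"
  shows "left_map (\<lambda>a. ring_frac R S \<one> s \<odot>\<^bsub>A\<^esub> a) (left_map (\<lambda>a. s \<odot>\<^bsub>AR\<^esub> a) z) = z"
proof -
  have "Poly_Mapping.keys z \<subseteq> carrier A \<times> carrier F"
    using assms(1) by simp
  then show ?thesis
    by (induction z rule: frag_induction) (auto simp: frac_smult_scalar_frac assms(2))
qed

lemma linear_maps_frac:
  assumes "s \<in> S"
  shows "(\<lambda>a. ring_frac R S \<one> s \<odot>\<^bsub>A\<^esub> a) \<in> linear_maps RS A A"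
  by (rule localized.scalar_linear_map) (use assms in simp)

text \<open>
  Elements of \<open>S\<close> act invertibly on \<open>AR \<otimes> F\<close>, since they do so on \<open>A\<close>.  This removes the scalar that
  distinguishes uniform exactness from exactness.
\<close>

lemma eq_unscale:
  assumes "z \<in> tensor_reps A F" "s \<in> S" "tensor_eq R AR F (left_map (\<lambda>a. s \<odot>\<^bsub>AR\<^esub> a) z) w"
  shows "tensor_eq R AR F z (left_map (\<lambda>a. ring_frac R S \<one> s \<odot>\<^bsub>A\<^esub> a) w)"
  using tensor_eq_left_map[OF restricted.tensor_modules_axioms restricted.tensor_modules_axioms
      linear_maps_restrict_scalars[OF linear_maps_frac[OF assms(2)] scalar_frac_ring_hom] assms(3)]
  by (simp add: left_map_unscale[OF assms(1,2), simplified])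

end

lemma left_map_commute:
  assumes "f \<in> linear_maps R A B" "r \<in> carrier R" "Poly_Mapping.keys z \<subseteq> carrier A \<times> Y"
  shows "left_map (\<lambda>b. r \<odot>\<^bsub>B\<^esub> b) (left_map f z) = left_map f (left_map (\<lambda>a. r \<odot>\<^bsub>A\<^esub> a) z)"
  using assms(3)
  by (induction z rule: frag_induction) (auto simp: linear_maps_smult[OF assms(1,2)])

text \<open>
  If a multiple \<open>s \<cdot> z\<close>, read over \<open>R\<close>, is in the image of \<open>f \<otimes> id\<close>, then so is \<open>z\<close> over the localized
  ring: dividing a preimage by \<open>s\<close> commutes with \<open>f\<close>, and localization is natural.  Both exactness in
  the middle and surjectivity on the right follow from this.
\<close>

lemma preimage_localized:
  assumes "localized_tensor R F S A" "localized_tensor R F S B" "f \<in> linear_maps (loc_ring R S) A B"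
    and z: "z \<in> tensor_reps B (loc_module R S F)" and w: "w \<in> tensor_reps A F" and "s \<in> S"
    and eq: "tensor_eq R (restrict_scalars (scalar_frac R S) B) F
      (left_map (\<lambda>b. scalar_frac R S s \<odot>\<^bsub>B\<^esub> b) (delocalize_tensor R S F B z)) (left_map f w)"
  shows "\<exists>w\<in>tensor_reps A (loc_module R S F).
    tensor_eq (loc_ring R S) B (loc_module R S F) z (left_map f w)"
proof -
  interpret A: localized_tensor R F S A by fact
  interpret B: localized_tensor R F S B by fact
  let ?w = "left_map (\<lambda>a. ring_frac R S \<one>\<^bsub>R\<^esub> s \<odot>\<^bsub>A\<^esub> a) w"
  have keys: "?w \<in> tensor_reps A F"
    using w keys_left_map[of w "carrier A" "carrier F" "\<lambda>a. ring_frac R S \<one>\<^bsub>R\<^esub> s \<odot>\<^bsub>A\<^esub> a" "carrier A"]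
    by (simp add: assms(6))
  have "tensor_eq R B.AR F (delocalize_tensor R S F B z)
      (left_map (\<lambda>b. ring_frac R S \<one>\<^bsub>R\<^esub> s \<odot>\<^bsub>B\<^esub> b) (left_map f w))"
    using B.eq_unscale[OF B.keys_delocalize_tensor[OF z] \<open>s \<in> S\<close>] eq by simp
  also have "left_map (\<lambda>b. ring_frac R S \<one>\<^bsub>R\<^esub> s \<odot>\<^bsub>B\<^esub> b) (left_map f w) = left_map f ?w"
    by (rule left_map_commute[OF assms(3)]) (use w assms(6) in auto)
  finally have "tensor_eq B.RS B B.FS (localize_tensor R S F (delocalize_tensor R S F B z))
      (localize_tensor R S F (left_map f ?w))"
    by (rule B.localize_tensor_eq)
  then have "tensor_eq B.RS B B.FS z (left_map f (localize_tensor R S F ?w))"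
    unfolding left_map_localize_tensor
    by (rule B.localized.eq_trans[OF B.localized.eq_sym[OF B.localize_delocalize[OF z]]])
  then show ?thesis
    using A.keys_localize_tensor[OF keys] by blast
qed

section \<open>Flatness of the localization\<close>

theorem corollary3p6:
  fixes R :: "'r ring" and S :: "'r set" and F :: "('r, 'f) module"
  assumes "cring R"
    and "submonoid S R"
    and "module R F"
    and "u_S_flat_module TYPE('m) R S F"
  shows "flat_module TYPE('m) (loc_ring R S) (loc_module R S F)"
proof -
  let ?RS = "loc_ring R S" and ?FS = "loc_module R S F" and ?h = "scalar_frac R S"
  let ?\<Phi> = "localize_tensor R S F" and ?\<Psi> = "delocalize_tensor R S F"
  interpret F: localization R F S
    using assms(2,3) by (simp add: localization_def localization_axioms_def)
  show ?thesis
    unfolding flat_module_def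
  proof (intro conjI allI impI)
    show "module ?RS ?FS" by (rule F.module_loc_module)
    fix A B C :: "(('r \<times> 'r) set, 'm) module" and f g :: "'m \<Rightarrow> 'm"
    assume modules: "module ?RS A" "module ?RS B" "module ?RS C"
      and f: "f \<in> linear_maps ?RS A B" and g: "g \<in> linear_maps ?RS B C"
      and exact: "short_exact A B C f g"
    interpret A: localized_tensor R F S A
      using F.localization_axioms modules by (simp add: localized_tensor_def)
    interpret B: localized_tensor R F S B
      using F.localization_axioms modules by (simp add: localized_tensor_def)
    interpret C: localized_tensor R F S C
      using F.localization_axioms modules by (simp add: localized_tensor_def)
    let ?A = "restrict_scalars ?h A" and ?B = "restrict_scalars ?h B" and ?C = "restrict_scalars ?h C"
    note fR = linear_maps_restrict_scalars[OF f F.scalar_frac_ring_hom]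
    note gR = linear_maps_restrict_scalars[OF g F.scalar_frac_ring_hom]
    interpret restricted: tensor_sequence R ?A ?B ?C F f g
      by unfold_locales (rule fR gR)+
    interpret localized: tensor_sequence ?RS A B C ?FS f g
      by unfold_locales (rule f g)+
    have "u_S_short_exact S ?A ?B ?C f g"
      by (rule short_exact_imp_u_S_short_exact[OF _ A.module_restricted B.module_restricted
            C.module_restricted submonoid.one_closed[OF assms(2)]])
         (simp add: short_exact_restrict_scalars exact)
    then have "u_S_short_exact S (tensor_product R ?A F) (tensor_product R ?B F) (tensor_product R ?C F)
        (tensor_map R ?B F f) (tensor_map R ?C F g)"
      using assms(4) fR gR
        A.module_restricted B.module_restricted C.module_restricted
      unfolding u_S_flat_module_def by blast
    \<comment> \<open>The three witnesses need not coincide; each exactness claim uses its own.\<close>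
    note u_S_exact = restricted.u_S_short_exactD[OF this submonoid.subset[OF assms(2)]]
    obtain s where s: "s \<in> S"
      and left: "\<forall>z\<in>tensor_reps ?A F. tensor_eq R ?B F (left_map f z) 0 \<longrightarrow>
        tensor_eq R ?A F (left_map (\<lambda>x. s \<odot>\<^bsub>?A\<^esub> x) z) 0"
      using u_S_exact(1) by (rule bexE)
    obtain t where t: "t \<in> S"
      and middle: "\<forall>z\<in>tensor_reps ?B F. tensor_eq R ?C F (left_map g z) 0 \<longrightarrow>
        (\<exists>w\<in>tensor_reps ?A F. tensor_eq R ?B F (left_map (\<lambda>x. t \<odot>\<^bsub>?B\<^esub> x) z) (left_map f w))"
      using u_S_exact(2) by (rule bexE)
    obtain u where u: "u \<in> S"
      and right: "\<forall>z\<in>tensor_reps ?C F.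
        \<exists>w\<in>tensor_reps ?B F. tensor_eq R ?C F (left_map (\<lambda>x. u \<odot>\<^bsub>?C\<^esub> x) z) (left_map g w)"
      using u_S_exact(3) by (rule bexE)
    have \<Psi>_zero: "?\<Psi> X 0 = 0" for X :: "(('r \<times> 'r) set, 'm) module"
      by (simp add: delocalize_tensor_def)
    have \<Phi>_zero: "?\<Phi> 0 = 0"
      by (simp add: localize_tensor_def)
    show "short_exact (tensor_product ?RS A ?FS) (tensor_product ?RS B ?FS) (tensor_product ?RS C ?FS)
        (tensor_map ?RS B ?FS f) (tensor_map ?RS C ?FS g)"
    proof (rule localized.short_exactI)
      fix z assume z: "z \<in> tensor_reps A ?FS" "tensor_eq ?RS B ?FS (left_map f z) 0"
      have "tensor_eq R ?B F (left_map f (?\<Psi> A z)) 0"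
        using B.delocalize_tensor_eq[OF z(2)] z(1)
        by (simp add: \<Psi>_zero left_map_delocalize_tensor[OF A.localized_tensor_axioms f])
      then have "tensor_eq R ?A F (left_map (\<lambda>x. s \<odot>\<^bsub>?A\<^esub> x) (?\<Psi> A z)) 0"
        using left A.keys_delocalize_tensor[OF z(1)] by simp
      \<comment> \<open>Multiplication by \<open>s\<close> is injective on the tensor product.\<close>
      then have "tensor_eq R ?A F (?\<Psi> A z) 0"
        using A.eq_unscale[OF A.keys_delocalize_tensor[OF z(1)] s] by (metis left_map_simps(1))
      then have "tensor_eq ?RS A ?FS (?\<Phi> (?\<Psi> A z)) 0"
        using A.localize_tensor_eq \<Phi>_zero by metis
      then show "tensor_eq ?RS A ?FS z 0"
        using A.localize_delocalize[OF z(1)] by (metis A.localized.eq_sym A.localized.eq_trans)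
    next
      fix w assume w: "w \<in> tensor_reps A ?FS"
      have gf: "g (f a) = \<zero>\<^bsub>C\<^esub>" if "a \<in> carrier A" for a
        using exact that by (auto simp: short_exact_def exact_at_def a_kernel_def')
      show "tensor_eq ?RS C ?FS (left_map g (left_map f w)) 0"
        by (rule C.localized.eq_additive_maps[where h = "\<lambda>w. left_map g (left_map f w)" and h' = "\<lambda>_. 0"
              and X = "carrier A \<times> carrier ?FS"])
           (use w in \<open>auto simp: gf C.localized.eq_zero_left\<close>)
    next
      fix z assume z: "z \<in> tensor_reps B ?FS" "tensor_eq ?RS C ?FS (left_map g z) 0"
      have "tensor_eq R ?C F (left_map g (?\<Psi> B z)) 0"
        using C.delocalize_tensor_eq[OF z(2)] z(1)
        by (simp add: \<Psi>_zero left_map_delocalize_tensor[OF B.localized_tensor_axioms g])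
      then obtain w where w: "w \<in> tensor_reps A F"
        "tensor_eq R ?B F (left_map (\<lambda>x. t \<odot>\<^bsub>?B\<^esub> x) (?\<Psi> B z)) (left_map f w)"
        using middle B.keys_delocalize_tensor[OF z(1)] by auto
      then show "\<exists>w\<in>tensor_reps A ?FS. tensor_eq ?RS B ?FS z (left_map f w)"
        using preimage_localized[OF A.localized_tensor_axioms B.localized_tensor_axioms f z(1) w(1) t]
        by simp
    next
      fix z assume z: "z \<in> tensor_reps C ?FS"
      obtain w where w: "w \<in> tensor_reps B F"
        "tensor_eq R ?C F (left_map (\<lambda>x. u \<odot>\<^bsub>?C\<^esub> x) (?\<Psi> C z)) (left_map g w)"
        using right C.keys_delocalize_tensor[OF z] by auto
      then show "\<exists>w\<in>tensor_reps B ?FS. tensor_eq ?RS C ?FS z (left_map g w)"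
        using preimage_localized[OF B.localized_tensor_axioms C.localized_tensor_axioms g z w(1) u]
        by simp
    qed
  qed
qed

end
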